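(* Let $\mathcal{P}_1$ be a set of $m$ points on a curve $\gamma$ of fixed degree $r$ in $\mathbb{R}^2$, and let $\mathcal{P}_2$ be a set of $n$ points in $\mathbb{R}^2$. Then $$D(\mathcal{P}_1,\mathcal{P}_2)=\begin{cases}\Omega\left(m^{1/2}n^{1/2}\log^{-1/2}n\right), & \text{when } m=\Omega\left(n^{1/2}\log^{-1/3}n\right),\\ \Omega\left(m^{1/3}n^{1/2}\right), & \text{when } m=O\left(n^{1/2}\log^{-1/3}n\right).\end{cases}$$
   Context: For finite sets $\mathcal{P}_1,\mathcal{P}_2\subset\mathbb{R}^2$, $D(\mathcal{P}_1,\mathcal{P}_2)$ denotes the number of distinct distances between the two sets, i.e. the number of distinct values of the Euclidean distance $|ab|$ with $a\in\mathcal{P}_1$ and $b\in\mathcal{P}_2$. A curve of degree $r$ in $\mathbb{R}^2$ is a real algebraic curve $V(f)=\{p\in\mathbb{R}^2: f(p)=0\}$ with $f\in\mathbb{R}[x,y]$ of degree $r$; it may be reducible. The set $\mathcal{P}_2$ is arbitrary. The degree $r$ is fixed (it does not vary with $m$ and $n$), and the constants implied by the asymptotic notation $\Omega(\cdot)$ and $O(\cdot)$ may depend on $r$. Notation such as $\log^{-1/2}n$ means $(\log n)^{-1/2}$.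
   Formalization: Both sets are assumed to have at least two points (m ≥ 2, n ≥ 2): for m = 1 the second bound fails when P_2 lies on a circle centred at the single point of P_1, and for n = 1 the factor log^{-1/2} n is undefined. *)

theory Defs
  imports "HOL-Analysis.Analysis" "HOL-Computational_Algebra.Polynomial"
begin

text \<open>
  A polynomial in \<open>\<real>[x, y]\<close> is an element of \<open>(\<real>[x])[y]\<close>, i.e. of type \<open>real poly poly\<close>: the
  coefficient of \<open>x\<^sup>i y\<^sup>j\<close> in \<open>f\<close> is \<open>coeff (coeff f j) i\<close>.
\<close>

text \<open>The inner \<open>poly\<close> substitutes a constant for the outer variable \<open>y\<close>, the outer one evaluates at \<open>x\<close>.\<close>

definition bivariate_eval :: "real poly poly \<Rightarrow> real^2 \<Rightarrow> real"
  where "bivariate_eval f p = poly (poly f [:p $ 2:]) (p $ 1)"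

text \<open>Only meaningful for \<open>f \<noteq> 0\<close>.\<close>

definition total_degree :: "real poly poly \<Rightarrow> nat"
  where "total_degree f = Max {i + j | i j. coeff (coeff f j) i \<noteq> 0}"

definition plane_curve :: "nat \<Rightarrow> (real^2) set \<Rightarrow> bool"
  where "plane_curve r \<gamma> \<longleftrightarrow>
    (\<exists>f. f \<noteq> 0 \<and> total_degree f = r \<and> \<gamma> = {p. bivariate_eval f p = 0})"

definition num_distances :: "(real^2) set \<Rightarrow> (real^2) set \<Rightarrow> nat"
  where "num_distances P Q = card {dist a b | a b. a \<in> P \<and> b \<in> Q}"

end

theory Submission
  imports Defs
begin

text \<open>
  Szekely's crossing argument gives the stronger bound \<open>D \<ge> c \<surd>(m n)\<close> for all \<open>m, n \<ge> 2\<close>. Draw around every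
  point of \<open>P\<^sub>1\<close> the circles through the points of \<open>P\<^sub>2\<close>, and join the points of \<open>P\<^sub>2\<close> that are consecutive
  on a circle. There are about \<open>m n\<close> arcs and at most \<open>O(m\<^sup>2 D\<^sup>2)\<close> crossings, so the crossing lemma yields
  \<open>m n = O(D\<^sup>2)\<close> as long as every pair of points is joined by boundedly many arcs. The arcs joining \<open>b\<close> and \<open>b'\<close>
  are centred on the bisector of \<open>b\<close> and \<open>b'\<close>, which contains at most \<open>r\<close> points of the curve unless it is a
  component of it. If few points of \<open>P\<^sub>1\<close> lie on the at most \<open>r\<close> lines contained in the curve, these points are
  dropped. Otherwise a single line carries a positive proportion of \<open>P\<^sub>1\<close>, and it suffices to keep the points
  of \<open>P\<^sub>2\<close> on one side of it, no two of which have that line as bisector. The argument needs \<open>m \<le> n\<close>; for \<open>m > n\<close>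
  a circle meets the curve in boundedly many points unless it is contained in it, which gives \<open>D \<ge> c m\<close>.

  Cutting the circles into semicircles makes all arcs monotone in the abscissa, so that the linear bound on
  the number of edges of a plane graph becomes a statement about the vertical order of the arcs in finitely
  many columns and no topology of the plane is needed.
\<close>

section \<open>Monotone drawings in integer columns\<close>

text \<open>The losses in the crossing argument decide which other bounds are needed. The last point
  on each semicircle starts no arc, so up to 2 m D of the m n incidences yield none. If D exceeds
  about n / 4, too few arcs may remain; then D >= c n and D >= c m together give the result. The
  averaging in the crossing lemma also needs m to be at least a constant multiple of the
  multiplicity. If m is bounded, n <= 2 D^2 suffices, which holds because two circles about
  different centres meet in at most two points. The bounds D >= c m and n <= 2 D^2 each take two
  points of one set as centres: a single point at the centre of a circle through the other set sees
  only one distance, and this is where m, n >= 2 enters. Parallel arcs are treated by keeping one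
  per pair of points, at the cost of a factor K in the number of edges, so the crossing lemma is
  needed for simple graphs only. Passing to subsets is harmless: D can only drop, while m and n lose
  constant factors.\<close>

text \<open>A vertex is identified with its column, so an edge is a pair of columns and there are no parallel edges.
  \<open>Y\<close> gives the heights of the vertices and \<open>y e i\<close> the height at which the edge \<open>e\<close> passes column \<open>i\<close>;
  values of \<open>y e\<close> outside the range of \<open>e\<close> are irrelevant.\<close>

definition drawing :: "int set \<Rightarrow> (int \<times> int) set \<Rightarrow> (int \<Rightarrow> real) \<Rightarrow> (int \<times> int \<Rightarrow> int \<Rightarrow> real) \<Rightarrow> bool"
  where "drawing V E Y y \<longleftrightarrow> finite V \<and> E \<subseteq> V \<times> V \<and>
    (\<forall>e\<in>E. fst e < snd e \<and> y e (fst e) = Y (fst e) \<and> y e (snd e) = Y (snd e)) \<and>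
    (\<forall>e\<in>E. \<forall>z\<in>V. fst e < z \<and> z < snd e \<longrightarrow> y e z \<noteq> Y z) \<and>
    (\<forall>e\<in>E. \<forall>f\<in>E. \<forall>i. e \<noteq> f \<and> i \<in> {fst e..snd e} \<inter> {fst f..snd f} \<and> y e i = y f i
       \<longrightarrow> i \<in> {fst e, snd e} \<inter> {fst f, snd f})"

text \<open>A crossing is an exchange of order between two neighbouring columns. The lower edge at
  the left column comes first in the triple, so each exchange is counted once; a pair of edges may
  still cross in several places.\<close>

definition crossings :: "(int \<times> int) set \<Rightarrow> (int \<times> int \<Rightarrow> int \<Rightarrow> real)
    \<Rightarrow> ((int \<times> int) \<times> (int \<times> int) \<times> int) set"
  where "crossings E y = {(e, f, i). e \<in> E \<and> f \<in> E \<and> i \<in> {fst e..<snd e} \<inter> {fst f..<snd f} \<and>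
    y e i < y f i \<and> y f (i + 1) < y e (i + 1)}"

lemma drawing_finite: "drawing V E Y y \<Longrightarrow> finite V \<and> finite E"
  unfolding drawing_def by (meson finite_SigmaI finite_subset)

lemma drawing_subset: "drawing V E Y y \<Longrightarrow> E \<subseteq> V \<times> V"
  unfolding drawing_def by (elim conjE)

lemma drawing_edge:
  assumes "drawing V E Y y" "e \<in> E"
  shows "fst e < snd e" "fst e \<in> V" "snd e \<in> V" "y e (fst e) = Y (fst e)" "y e (snd e) = Y (snd e)"
  using assms unfolding drawing_def by (auto dest!: subsetD)

lemma drawing_vertex:
  assumes "drawing V E Y y" "e \<in> E" "z \<in> V" "fst e < z" "z < snd e"
  shows "y e z \<noteq> Y z"
  using assms unfolding drawing_def by blast

lemma drawing_distinct:
  assumes "drawing V E Y y" "e \<in> E" "f \<in> E" "e \<noteq> f" "fst e \<le> i" "i \<le> snd e" "fst f \<le> i" "i \<le> snd f"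
    "y e i = y f i"
  shows "(i = fst e \<or> i = snd e) \<and> (i = fst f \<or> i = snd f)"
proof -
  have "\<forall>e\<in>E. \<forall>f\<in>E. \<forall>i. e \<noteq> f \<and> i \<in> {fst e..snd e} \<inter> {fst f..snd f} \<and> y e i = y f i
       \<longrightarrow> i \<in> {fst e, snd e} \<inter> {fst f, snd f}" using assms(1) unfolding drawing_def by blast
  from this[rule_format, of e f i] show ?thesis using assms by auto
qed

lemma drawingI:
  assumes "finite V" "E \<subseteq> V \<times> V"
    and "\<And>e. e \<in> E \<Longrightarrow> fst e < snd e \<and> y e (fst e) = Y (fst e) \<and> y e (snd e) = Y (snd e)"
    and "\<And>e z. e \<in> E \<Longrightarrow> z \<in> V \<Longrightarrow> fst e < z \<Longrightarrow> z < snd e \<Longrightarrow> y e z \<noteq> Y z"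
    and "\<And>e f i. e \<in> E \<Longrightarrow> f \<in> E \<Longrightarrow> e \<noteq> f \<Longrightarrow> fst e \<le> i \<Longrightarrow> i \<le> snd e \<Longrightarrow> fst f \<le> i \<Longrightarrow> i \<le> snd f
      \<Longrightarrow> y e i = y f i \<Longrightarrow> (i = fst e \<or> i = snd e) \<and> (i = fst f \<or> i = snd f)"
  shows "drawing V E Y y"
  unfolding drawing_def
proof (intro conjI ballI allI impI)
  fix e f i assume "e \<in> E" "f \<in> E"
    "e \<noteq> f \<and> i \<in> {fst e..snd e} \<inter> {fst f..snd f} \<and> y e i = y f i"
  then show "i \<in> {fst e, snd e} \<inter> {fst f, snd f}" using assms(5)[of e f i] by auto
qed (use assms in auto)

lemma drawing_subgraph:
  assumes d: "drawing V E Y y" and "W \<subseteq> V" "F \<subseteq> E" "F \<subseteq> W \<times> W"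
  shows "drawing W F Y y"
proof (rule drawingI)
  have 1: "\<And>e. e \<in> F \<Longrightarrow> e \<in> E" "\<And>z. z \<in> W \<Longrightarrow> z \<in> V" using assms by auto
  show "finite W" using drawing_finite[OF d] assms(2) finite_subset by blast
  show "fst e < snd e \<and> y e (fst e) = Y (fst e) \<and> y e (snd e) = Y (snd e)" if "e \<in> F" for e
    using drawing_edge[OF d 1(1)[OF that]] by blast
  show "y e z \<noteq> Y z" if "e \<in> F" "z \<in> W" "fst e < z" "z < snd e" for e z
    using drawing_vertex[OF d 1(1)[OF that(1)] 1(2)[OF that(2)] that(3,4)] .
  show "(i = fst e \<or> i = snd e) \<and> (i = fst f \<or> i = snd f)"
    if "e \<in> F" "f \<in> F" "e \<noteq> f" "fst e \<le> i" "i \<le> snd e" "fst f \<le> i" "i \<le> snd f" "y e i = y f i"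
    for e f i
    using drawing_distinct[OF d 1(1)[OF that(1)] 1(1)[OF that(2)] that(3-8)] .
qed fact

lemma finite_crossings:
  assumes "drawing V E Y y"
  shows "finite (crossings E y)"
proof -
  have fin: "finite E" using drawing_finite[OF assms] by blast
  have "crossings E y \<subseteq> E \<times> E \<times> (\<Union>e\<in>E. {fst e..<snd e})"
    unfolding crossings_def by auto
  moreover have "finite (E \<times> E \<times> (\<Union>e\<in>E. {fst e..<snd e}))" using fin by simp
  ultimately show ?thesis by (rule finite_subset)
qed

section \<open>Reflection of a drawing in a vertical line\<close>

definition mirror_edges :: "(int \<times> int) set \<Rightarrow> (int \<times> int) set"
  where "mirror_edges E = (\<lambda>(l, r). (- r, - l)) ` E"

definition mirror_heights :: "(int \<times> int \<Rightarrow> int \<Rightarrow> real) \<Rightarrow> int \<times> int \<Rightarrow> int \<Rightarrow> real"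
  where "mirror_heights y = (\<lambda>(l, r) i. y (- r, - l) (- i))"

lemma mem_mirror_edges: "e \<in> mirror_edges E \<longleftrightarrow> (- snd e, - fst e) \<in> E"
  unfolding mirror_edges_def by (cases e) force

lemma mirror_mirror [simp]:
  "mirror_edges (mirror_edges E) = E" "mirror_heights (mirror_heights y) = y"
  by (auto simp: mem_mirror_edges mirror_heights_def)

lemma drawing_mirror:
  assumes d: "drawing V E Y y"
  shows "drawing (uminus ` V) (mirror_edges E) (\<lambda>i. Y (- i)) (mirror_heights y)"
proof (rule drawingI)
  show "finite (uminus ` V)" using drawing_finite[OF d] by simp
  show "mirror_edges E \<subseteq> uminus ` V \<times> uminus ` V"
    using drawing_subset[OF d] unfolding mirror_edges_def by auto
  have m: "mirror_heights y e i = y (- snd e, - fst e) (- i)" for e i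
    unfolding mirror_heights_def by (simp add: split_beta)
  show "fst e < snd e \<and> mirror_heights y e (fst e) = Y (- fst e) \<and> mirror_heights y e (snd e) = Y (- snd e)"
    if "e \<in> mirror_edges E" for e
    using that drawing_edge[OF d, of "(- snd e, - fst e)"] by (simp add: mem_mirror_edges m)
  show "mirror_heights y e z \<noteq> Y (- z)"
    if "e \<in> mirror_edges E" "z \<in> uminus ` V" "fst e < z" "z < snd e" for e z
    using that drawing_vertex[OF d, of "(- snd e, - fst e)" "- z"]
    by (auto simp: mem_mirror_edges m)
  show "(i = fst e \<or> i = snd e) \<and> (i = fst f \<or> i = snd f)"
    if "e \<in> mirror_edges E" "f \<in> mirror_edges E" "e \<noteq> f" "fst e \<le> i" "i \<le> snd e"
      "fst f \<le> i" "i \<le> snd f" "mirror_heights y e i = mirror_heights y f i" for e f i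
    using that drawing_distinct[OF d, of "(- snd e, - fst e)" "(- snd f, - fst f)" "- i"]
    by (auto simp: mem_mirror_edges m prod_eq_iff)
qed

text \<open>Read from right to left, the edge that was above at column \<open>i\<close> is the one
  that starts below, so the two edges trade places. The gap between \<open>i\<close> and
  \<open>i + 1\<close> becomes the gap that begins at \<open>- i - 1\<close>.\<close>

lemma crossings_mirror:
  "(e, f, i) \<in> crossings (mirror_edges E) (mirror_heights y) \<longleftrightarrow>
   ((- snd f, - fst f), (- snd e, - fst e), - i - 1) \<in> crossings E y"
  unfolding crossings_def by (auto simp: mem_mirror_edges mirror_heights_def split: prod.splits)

lemma card_crossings_mirror:
  "card (crossings (mirror_edges E) (mirror_heights y)) = card (crossings E y)"
proof (rule bij_betw_same_card)
  let ?h = "\<lambda>(e, f, i). ((- snd f, - fst f), (- snd e, - fst e), - i - 1)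
    :: (int \<times> int) \<times> (int \<times> int) \<times> int"
  show "bij_betw ?h (crossings (mirror_edges E) (mirror_heights y)) (crossings E y)"
  proof (rule bij_betw_byWitness[where f' = ?h])
    show "?h ` crossings E y \<subseteq> crossings (mirror_edges E) (mirror_heights y)"
      by (auto simp: crossings_mirror)
  qed (auto simp: crossings_mirror)
qed

lemma noncrossing_mirror:
  assumes "crossings E y = {}"
  shows "crossings (mirror_edges E) (mirror_heights y) = {}"
proof -
  have "x \<notin> crossings (mirror_edges E) (mirror_heights y)" for x
    by (cases x) (use assms in \<open>simp add: crossings_mirror\<close>)
  then show ?thesis by blast
qed

section \<open>The linear bound on the number of edges of a drawing without crossings\<close>

text \<open>Without crossings the weak order passes from one column to the next, and distinct edges
  have equal heights only at ends of both. Moving to the right, strictness can therefore be lost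
  only at a shared right end.\<close>

lemma noncrossing_forward:
  assumes d: "drawing V E Y y" and nc: "crossings E y = {}" and ef: "e \<in> E" "f \<in> E" "e \<noteq> f"
    and i: "fst e \<le> i" "fst f \<le> i" "y e i < y f i" and j: "i \<le> j" "j \<le> snd e" "j \<le> snd f"
  shows "y e j < y f j \<or> y e j = y f j \<and> j = snd e \<and> j = snd f"
  using j
proof (induction j rule: int_ge_induct)
  case base
  then show ?case using i by simp
next
  case (step j)
  then have lt: "y e j < y f j" by auto
  have "(e, f, j) \<notin> crossings E y" using nc by simp
  then have le: "y e (j + 1) \<le> y f (j + 1)"
    unfolding crossings_def using ef lt step.prems step.hyps i by auto
  moreover have "j + 1 = snd e \<and> j + 1 = snd f" if "y e (j + 1) = y f (j + 1)"
    using drawing_distinct[OF d ef(1,2,3), of "j + 1"] that step i by auto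
  ultimately show ?case by (meson order_le_less)
qed

lemma noncrossing_le:
  assumes d: "drawing V E Y y" and nc: "crossings E y = {}" and ef: "e \<in> E" "f \<in> E" "e \<noteq> f"
    and i: "fst e \<le> i" "fst f \<le> i" "i \<le> snd e" "i \<le> snd f" "y e i < y f i"
    and j: "fst e \<le> j" "fst f \<le> j" "j \<le> snd e" "j \<le> snd f"
  shows "y e j \<le> y f j"
proof (cases "i \<le> j")
  case True
  then show ?thesis using noncrossing_forward[OF d nc ef i(1,2,5) True j(3,4)] by auto
next
  case False
  then show ?thesis using noncrossing_forward[OF d nc ef(2,1) ef(3)[symmetric] j(2,1), of i] i by force
qed

lemma noncrossing_less:
  assumes d: "drawing V E Y y" and nc: "crossings E y = {}" and ef: "e \<in> E" "f \<in> E" "e \<noteq> f"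
    and i: "fst e \<le> i" "fst f \<le> i" "i \<le> snd e" "i \<le> snd f" "y e i < y f i"
    and j: "fst e \<le> j" "fst f \<le> j" "j \<le> snd e" "j \<le> snd f"
    and ne: "(j \<noteq> fst e \<and> j \<noteq> snd e) \<or> (j \<noteq> fst f \<and> j \<noteq> snd f)"
  shows "y e j < y f j"
  using noncrossing_le[OF d nc ef i j] drawing_distinct[OF d ef j(1,3,2,4)] ne by force

text \<open>The vertex is what lies above: \<open>e\<close> is the first edge met when descending
  vertically from \<open>z\<close>. A vertex thus determines its edge, which makes it usable for
  charging.\<close>

definition directly_above :: "int set \<Rightarrow> (int \<times> int) set \<Rightarrow> (int \<Rightarrow> real) \<Rightarrow> (int \<times> int \<Rightarrow> int \<Rightarrow> real)
    \<Rightarrow> int \<Rightarrow> int \<times> int \<Rightarrow> bool"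
  where "directly_above V E Y y z e \<longleftrightarrow> z \<in> V \<and> e \<in> E \<and> fst e < z \<and> z < snd e \<and> y e z < Y z \<and>
    (\<forall>h\<in>E. fst h < z \<and> z < snd h \<longrightarrow> \<not> (y e z < y h z \<and> y h z < Y z))"

lemma directly_above_unique:
  assumes d: "drawing V E Y y" and "directly_above V E Y y z e" "directly_above V E Y y z f"
  shows "e = f"
proof (rule ccontr)
  assume "e \<noteq> f"
  then have "y e z \<noteq> y f z"
    using drawing_distinct[OF d, of e f z] assms(2,3) unfolding directly_above_def by force
  then show False
    using assms(2,3) unfolding directly_above_def by (meson linorder_neqE)
qed

lemma directly_above_mirror:
  assumes "directly_above (uminus ` V) (mirror_edges E) (\<lambda>i. Y (- i)) (mirror_heights y) z e"
  shows "directly_above V E Y y (- z) (- snd e, - fst e)"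
proof -
  have e: "mirror_heights y e z = y (- snd e, - fst e) (- z)"
    unfolding mirror_heights_def by (simp add: split_beta)
  have "\<not> (y (- snd e, - fst e) (- z) < y h (- z) \<and> y h (- z) < Y (- z))"
    if h: "h \<in> E" "fst h < - z" "- z < snd h" for h
  proof -
    have "(- snd h, - fst h) \<in> mirror_edges E" using h by (simp add: mem_mirror_edges)
    moreover have "mirror_heights y (- snd h, - fst h) z = y h (- z)"
      unfolding mirror_heights_def by simp
    ultimately show ?thesis
      using assms h unfolding directly_above_def e
      by (metis fst_conv snd_conv minus_less_iff less_minus_iff)
  qed
  then show ?thesis using assms unfolding directly_above_def
    by (auto simp: mem_mirror_edges e)
qed

text \<open>The edges \<open>e\<close> and \<open>f\<close> bound a wedge with apex at their common
  left end, and \<open>f\<close> ends inside the range of \<open>e\<close>. The leftmost vertex of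
  this wedge is charged. An edge \<open>h\<close> separating it from \<open>e\<close> would,
  followed to the left, have to pass through the apex, or leave the apex between \<open>e\<close>
  and \<open>f\<close>, or start at a vertex of the wedge further left; all three are
  impossible.\<close>

lemma charge_left:
  assumes d: "drawing V E Y y" and nc: "crossings E y = {}"
    and e: "e \<in> E" and f: "f \<in> E" "fst f = fst e" "y e (fst e + 1) < y f (fst e + 1)"
    and next_above: "\<And>h. h \<in> E \<Longrightarrow> fst h = fst e \<Longrightarrow> y e (fst e + 1) < y h (fst e + 1) \<Longrightarrow>
      y f (fst e + 1) \<le> y h (fst e + 1)"
    and short: "snd f < snd e"
  shows "\<exists>z. directly_above V E Y y z e"
proof -
  define u where "u = fst e"
  have ne: "e \<noteq> f" using short by auto
  have lte: "fst e < snd e" and ltf: "fst f < snd f" using drawing_edge(1)[OF d e] drawing_edge(1)[OF d f(1)] by auto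
  have above: "y e i < y f i" if "u < i" "i \<le> snd f" for i
    by (rule noncrossing_less[OF d nc e f(1) ne, of "u + 1"]) (use that f short lte ltf u_def in auto)
  \<comment> \<open>The upper boundary is included, so that the right end of \<open>f\<close>
    belongs to the wedge and \<open>Z\<close> is not empty.\<close>
  define Z where "Z = {z \<in> V. u < z \<and> z \<le> snd f \<and> y e z < Y z \<and> Y z \<le> y f z}"
  have "finite Z" using drawing_finite[OF d] unfolding Z_def by auto
  moreover have "snd f \<in> Z"
    using drawing_edge[OF d f(1)] above[of "snd f"] f ltf unfolding Z_def u_def by auto
  ultimately have zZ: "Min Z \<in> Z" and zmin: "\<And>x. x \<in> Z \<Longrightarrow> Min Z \<le> x"
    using Min_in[of Z] Min_le[of Z] by blast+
  define z where "z = Min Z"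
  have z: "z \<in> V" "u < z" "z \<le> snd f" "y e z < Y z" "Y z \<le> y f z"
    using zZ z_def Z_def by auto
  have "\<not> (y e z < y h z \<and> y h z < Y z)" if h: "h \<in> E" "fst h < z" "z < snd h" for h
  proof
    assume c: "y e z < y h z \<and> y h z < Y z"
    then have hne: "e \<noteq> h" "h \<noteq> f" using z by auto
    have hf: "y h z < y f z" and eh: "y e z < y h z" using c z by auto
    have eh': "y e i < y h i" if "u \<le> i" "fst h \<le> i" "i \<le> z" "i \<noteq> u \<or> i \<noteq> fst h" for i
      by (rule noncrossing_less[OF d nc e h(1) hne(1), of z]) (use that z h short u_def eh in auto)
    have hf': "y h i < y f i" if "u \<le> i" "fst h \<le> i" "i \<le> z" "i \<noteq> u \<or> i \<noteq> fst h" for i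
      by (rule noncrossing_less[OF d nc h(1) f(1) hne(2), of z]) (use that z h f(2) short u_def hf in auto)
    consider "fst h < u" | "fst h = u" | "u < fst h" by linarith
    then show False
    proof cases
      case 1
      then show False using eh'[of u] hf'[of u] drawing_edge(4)[OF d e] drawing_edge(4)[OF d f(1)]
        f(2) z(2) u_def by auto
    next
      case 2
      then show False using eh'[of "u + 1"] hf'[of "u + 1"] next_above[OF h(1)] z(2) u_def by force
    next
      case 3
      then have "fst h \<in> Z"
        using eh'[of "fst h"] hf'[of "fst h"] drawing_edge[OF d h(1)] h(2) z(3) unfolding Z_def by force
      then show False using zmin[of "fst h"] h(2) z_def by auto
    qed
  qed
  then have "directly_above V E Y y z e"
    unfolding directly_above_def using z e short u_def by auto
  then show ?thesis ..
qed

text \<open>Heights are compared one column inside the edge, because all edges with the same left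
  end agree at that end.\<close>

definition top_left :: "(int \<times> int) set \<Rightarrow> (int \<times> int \<Rightarrow> int \<Rightarrow> real) \<Rightarrow> int \<times> int \<Rightarrow> bool"
  where "top_left E y e \<longleftrightarrow> (\<forall>h\<in>E. fst h = fst e \<longrightarrow> y h (fst e + 1) \<le> y e (fst e + 1))"

definition top_right :: "(int \<times> int) set \<Rightarrow> (int \<times> int \<Rightarrow> int \<Rightarrow> real) \<Rightarrow> int \<times> int \<Rightarrow> bool"
  where "top_right E y e \<longleftrightarrow> (\<forall>h\<in>E. snd h = snd e \<longrightarrow> y h (snd e - 1) \<le> y e (snd e - 1))"

text \<open>Two topmost edges at \<open>u\<close> would have equal heights at \<open>u + 1\<close>.
  For distinct edges this forces \<open>u + 1\<close> to be the right end of both, and then they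
  coincide.\<close>

lemma top_left_inj:
  assumes d: "drawing V E Y y"
  shows "inj_on fst {e \<in> E. top_left E y e}"
proof (rule inj_onI, rule ccontr)
  fix e f assume a: "e \<in> {e \<in> E. top_left E y e}" "f \<in> {e \<in> E. top_left E y e}" "fst e = fst f" "e \<noteq> f"
  then have "y e (fst e + 1) = y f (fst e + 1)" unfolding top_left_def by (auto intro!: antisym)
  then show False
    using drawing_distinct[OF d, of e f "fst e + 1"] drawing_edge(1)[OF d, of e]
      drawing_edge(1)[OF d, of f] a by (auto simp: prod_eq_iff)
qed

lemma top_right_inj:
  assumes d: "drawing V E Y y"
  shows "inj_on snd {e \<in> E. top_right E y e}"
proof (rule inj_onI, rule ccontr)
  fix e f assume a: "e \<in> {e \<in> E. top_right E y e}" "f \<in> {e \<in> E. top_right E y e}" "snd e = snd f" "e \<noteq> f"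
  then have "y e (snd e - 1) = y f (snd e - 1)" unfolding top_right_def by (auto intro!: antisym)
  then show False
    using drawing_distinct[OF d, of e f "snd e - 1"] drawing_edge(1)[OF d, of e]
      drawing_edge(1)[OF d, of f] a by (auto simp: prod_eq_iff)
qed

lemma obtain_next_above:
  fixes g :: "'a \<Rightarrow> real"
  assumes "finite E" "f0 \<in> E" "P f0" "c < g f0"
  obtains f where "f \<in> E" "P f" "c < g f" "\<And>h. h \<in> E \<Longrightarrow> P h \<Longrightarrow> c < g h \<Longrightarrow> g f \<le> g h"
proof -
  let ?S = "{h \<in> E. P h \<and> c < g h}"
  have "finite ?S" "?S \<noteq> {}" using assms by auto
  then obtain f where "is_arg_min g (\<lambda>x. x \<in> ?S) f" using ex_is_arg_min_if_finite by blast
  then show ?thesis using that[of f] unfolding is_arg_min_linorder by auto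
qed

text \<open>Let \<open>f\<close> and \<open>g\<close> be the next edges above \<open>e\<close> at
  its left and right end. If \<open>f\<close> ends early or \<open>g\<close> starts late, the wedge
  argument applies, directly or after reflection. Otherwise both extend beyond \<open>e\<close> on
  the far side: \<open>g\<close> is above \<open>f\<close> at the left end of \<open>e\<close> and
  below it at the right end, so they would cross.\<close>

lemma charge_interior:
  assumes d: "drawing V E Y y" and nc: "crossings E y = {}"
    and e: "e \<in> E" "\<not> top_left E y e" "\<not> top_right E y e"
  shows "\<exists>z. directly_above V E Y y z e"
proof -
  have fin: "finite E" using drawing_finite[OF d] by blast
  obtain f0 where "f0 \<in> E" "fst f0 = fst e" "y e (fst e + 1) < y f0 (fst e + 1)"
    using e(2) unfolding top_left_def by force
  from obtain_next_above[where P = "\<lambda>h. fst h = fst e" and c = "y e (fst e + 1)"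
      and g = "\<lambda>h. y h (fst e + 1)", OF fin this]
  obtain f where f: "f \<in> E" "fst f = fst e" "y e (fst e + 1) < y f (fst e + 1)"
    and fmin: "\<And>h. h \<in> E \<Longrightarrow> fst h = fst e \<Longrightarrow> y e (fst e + 1) < y h (fst e + 1) \<Longrightarrow>
      y f (fst e + 1) \<le> y h (fst e + 1)" by blast
  obtain g0 where "g0 \<in> E" "snd g0 = snd e" "y e (snd e - 1) < y g0 (snd e - 1)"
    using e(3) unfolding top_right_def by force
  from obtain_next_above[where P = "\<lambda>h. snd h = snd e" and c = "y e (snd e - 1)"
      and g = "\<lambda>h. y h (snd e - 1)", OF fin this]
  obtain g where g: "g \<in> E" "snd g = snd e" "y e (snd e - 1) < y g (snd e - 1)"
    and gmin: "\<And>h. h \<in> E \<Longrightarrow> snd h = snd e \<Longrightarrow> y e (snd e - 1) < y h (snd e - 1) \<Longrightarrow>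
      y g (snd e - 1) \<le> y h (snd e - 1)" by blast
  have ef: "e \<noteq> f" and eg: "e \<noteq> g" using f g by auto
  have lt: "fst e < snd e" "fst f < snd f" "fst g < snd g" 
    using drawing_edge(1)[OF d e(1)] drawing_edge(1)[OF d f(1)] drawing_edge(1)[OF d g(1)] by auto
  consider "snd f < snd e" | "fst e < fst g" | "snd e \<le> snd f" "fst g \<le> fst e" by linarith
  then show ?thesis
  proof cases
    case 1
    then show ?thesis using charge_left[OF d nc e(1) f fmin] by blast
  next
    case 2
    let ?m = "\<lambda>e::int \<times> int. (- snd e, - fst e)"
    have m: "mirror_heights y (?m h) i = y h (- i)" for h i unfolding mirror_heights_def by simp
    have "\<exists>z. directly_above (uminus ` V) (mirror_edges E) (\<lambda>i. Y (- i)) (mirror_heights y) z (?m e)"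
    proof (rule charge_left[OF drawing_mirror[OF d] noncrossing_mirror[OF nc], where f = "?m g"])
      fix h assume h: "h \<in> mirror_edges E" "fst h = fst (?m e)"
        "mirror_heights y (?m e) (fst (?m e) + 1) < mirror_heights y h (fst (?m e) + 1)"
      have "mirror_heights y h i = y (?m h) (- i)" for i using m[of "?m h" i] by simp
      then show "mirror_heights y (?m g) (fst (?m e) + 1) \<le> mirror_heights y h (fst (?m e) + 1)"
        using h gmin[of "?m h"] unfolding m by (auto simp: mem_mirror_edges)
    next
      show "?m e \<in> mirror_edges E" "?m g \<in> mirror_edges E"
        using e(1) g(1) by (simp_all add: mem_mirror_edges)
      show "mirror_heights y (?m e) (fst (?m e) + 1) < mirror_heights y (?m g) (fst (?m e) + 1)"
        using g(3) unfolding m by simp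
    qed (use g(2) 2 in simp_all)
    then obtain z where z: "directly_above (uminus ` V) (mirror_edges E) (\<lambda>i. Y (- i)) (mirror_heights y) z (?m e)" ..
    show ?thesis using directly_above_mirror[OF z] by auto
  next
    case 3
    have sf: "snd e < snd f" using 3 ef f(2) by (metis order_le_less prod_eqI)
    have sg: "fst g < fst e" using 3 eg g(2) by (metis order_le_less prod_eqI)
    have fg: "f \<noteq> g" using sf g by auto
    have "y e (fst e) < y g (fst e)"
      by (rule noncrossing_less[OF d nc e(1) g(1) eg, of "snd e - 1"]) (use g sg lt in auto)
    then have 1: "y f (fst e) < y g (fst e)"
      using drawing_edge(4)[OF d e(1)] drawing_edge(4)[OF d f(1)] f(2) by simp
    have "y e (snd e) < y f (snd e)"
      by (rule noncrossing_less[OF d nc e(1) f(1) ef, of "fst e + 1"]) (use f sf lt in auto)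
    then have 2: "y g (snd e) < y f (snd e)"
      using drawing_edge(5)[OF d e(1)] drawing_edge(5)[OF d g(1)] g(2) by simp
    have "y f (snd e) \<le> y g (snd e)"
      by (rule noncrossing_le[OF d nc f(1) g(1) fg, of "fst e"]) (use 1 f g sf sg lt in auto)
    then show ?thesis using 2 by simp
  qed
qed

text \<open>Every edge is the topmost one at its left end, or the topmost one at its right end, or the first edge
  directly below some vertex. Each vertex is charged at most once in each of the three ways.\<close>

lemma noncrossing_card_le:
  assumes d: "drawing V E Y y" and nc: "crossings E y = {}"
  shows "card E \<le> 3 * card V"
proof -
  have fin: "finite V" "finite E" using drawing_finite[OF d] by auto
  let ?L = "{e \<in> E. top_left E y e}" and ?R = "{e \<in> E. top_right E y e}"
  let ?I = "{e \<in> E. \<not> top_left E y e \<and> \<not> top_right E y e}"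
  have "card ?L \<le> card V"
    by (rule card_inj_on_le[OF top_left_inj[OF d] _ fin(1)]) (use drawing_edge[OF d] in auto)
  moreover have "card ?R \<le> card V"
    by (rule card_inj_on_le[OF top_right_inj[OF d] _ fin(1)]) (use drawing_edge[OF d] in auto)
  moreover have "card ?I \<le> card V"
  proof -
    obtain z where z: "\<And>e. e \<in> ?I \<Longrightarrow> directly_above V E Y y (z e) e"
      using charge_interior[OF d nc] by (metis (mono_tags, lifting) mem_Collect_eq)
    have "inj_on z ?I" by (rule inj_onI) (metis directly_above_unique[OF d] z)
    moreover have "z ` ?I \<subseteq> V" using z unfolding directly_above_def by auto
    ultimately show ?thesis using card_inj_on_le fin(1) by blast
  qed
  moreover have "card E \<le> card ?L + card ?R + card ?I"
  proof -
    have "E \<subseteq> ?L \<union> ?R \<union> ?I" by auto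
    then have "card E \<le> card (?L \<union> ?R \<union> ?I)" by (rule card_mono[rotated]) (use fin in auto)
    then show ?thesis using card_Un_le[of "?L \<union> ?R" ?I] card_Un_le[of ?L ?R] by linarith
  qed
  ultimately show ?thesis by linarith
qed

text \<open>Deleting an edge that takes part in a crossing lowers the number of edges by one and the
  number of crossings by at least one.\<close>

lemma card_edges_le_crossings:
  assumes "drawing V E Y y"
  shows "card E \<le> 3 * card V + card (crossings E y)"
  using assms
proof (induction "card E" arbitrary: E rule: less_induct)
  case less
  note d = less.prems
  have fin: "finite E" using drawing_finite[OF d] by auto
  show ?case
  proof (cases "crossings E y = {}")
    case True
    then show ?thesis using noncrossing_card_le[OF d] by simp
  next
    case False
    then obtain e f i where c: "(e, f, i) \<in> crossings E y" by auto
    then have e: "e \<in> E" unfolding crossings_def by auto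
    have d': "drawing V (E - {e}) Y y"
      by (rule drawing_subgraph[OF d]) (use drawing_subset[OF d] in auto)
    have lt: "card (E - {e}) < card E" using e fin by (meson card_Diff1_less)
    have "crossings (E - {e}) y \<subset> crossings E y" using c unfolding crossings_def by blast
    then have "card (crossings (E - {e}) y) < card (crossings E y)"
      using finite_crossings[OF d] psubset_card_mono by blast
    moreover have "card E = Suc (card (E - {e}))" using e fin by (metis card.remove)
    ultimately show ?thesis using less.hyps[OF lt d'] by linarith
  qed
qed

section \<open>The crossing lemma\<close>

definition swap_prefix :: "int \<times> int \<Rightarrow> int \<times> int \<Rightarrow> int \<Rightarrow> (int \<times> int \<Rightarrow> int \<Rightarrow> real) \<Rightarrow> int \<times> int \<Rightarrow> int \<Rightarrow> real"
  where "swap_prefix e f k y = (\<lambda>g i. if i \<le> k then y (if g = e then f else if g = f then e else g) i else y g i)"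

text \<open>Swapping the initial parts of two edges with a common left end removes their crossing at column \<open>k\<close>. The
  map \<open>h\<close> below injects the crossings of the new drawing into the old ones other than \<open>(e, f, k)\<close>: before
  column \<open>k\<close> it undoes the swap, and at column \<open>k\<close> it redirects a crossing with an edge that passes between
  \<open>e\<close> and \<open>f\<close> to the one of them that the edge crossed originally.\<close>

lemma uncross_left:
  assumes d: "drawing V E Y y" and c: "(e, f, k) \<in> crossings E y" and lef: "fst e = fst f"
  shows "drawing V E Y (swap_prefix e f k y) \<and>
    card (crossings E (swap_prefix e f k y)) < card (crossings E y)"
proof
  let ?y = "swap_prefix e f k y"
  define \<tau> where "\<tau> = (\<lambda>g. if g = e then f else if g = f then e else g)"
  have y_le: "?y g i = y (\<tau> g) i" if "i \<le> k" for g i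
    using that unfolding swap_prefix_def \<tau>_def by simp
  have y_gt: "?y g i = y g i" if "k < i" for g i
    using that unfolding swap_prefix_def by simp
  have ef: "e \<in> E" "f \<in> E" "fst e \<le> k" "k < snd e" "k < snd f" "y e k < y f k" "y f (k + 1) < y e (k + 1)"
    using c unfolding crossings_def by auto
  have ne: "e \<noteq> f" using ef by auto
  have \<tau>E: "\<tau> g \<in> E \<longleftrightarrow> g \<in> E" for g using ef unfolding \<tau>_def by auto
  have \<tau>inj: "\<tau> g = \<tau> h \<longleftrightarrow> g = h" for g h unfolding \<tau>_def by auto
  have \<tau>\<tau>: "\<tau> (\<tau> g) = g" for g unfolding \<tau>_def by auto
  have \<tau>fst: "fst (\<tau> g) = fst g" for g using lef unfolding \<tau>_def by auto
  have \<tau>snd: "i \<le> snd (\<tau> g) \<longleftrightarrow> i \<le> snd g" "i = snd (\<tau> g) \<longleftrightarrow> i = snd g" "i < snd (\<tau> g) \<longleftrightarrow> i < snd g"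
    if "i \<le> k" for i g
    using ef that unfolding \<tau>_def by auto
  show "drawing V E Y ?y"
  proof (rule drawingI)
    show "finite V" using drawing_finite[OF d] by simp
    show "E \<subseteq> V \<times> V" by (rule drawing_subset[OF d])
    show "fst g < snd g \<and> ?y g (fst g) = Y (fst g) \<and> ?y g (snd g) = Y (snd g)" if g: "g \<in> E" for g
    proof (intro conjI)
      have g': "\<tau> g \<in> E" using g \<tau>E by simp
      show "fst g < snd g" using drawing_edge[OF d g] by blast
      show "?y g (fst g) = Y (fst g)"
        using drawing_edge(4)[OF d g] drawing_edge(4)[OF d g'] \<tau>fst
        by (cases "fst g \<le> k") (auto simp: y_le y_gt)
      show "?y g (snd g) = Y (snd g)"
        using drawing_edge(5)[OF d g] drawing_edge(5)[OF d g'] \<tau>snd(2)[of "snd g" g]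
        by (cases "snd g \<le> k") (auto simp: y_le y_gt)
    qed
    show "?y g z \<noteq> Y z" if g: "g \<in> E" "z \<in> V" "fst g < z" "z < snd g" for g z
    proof (cases "z \<le> k")
      case True
      then show ?thesis using drawing_vertex[OF d, of "\<tau> g" z] g \<tau>E \<tau>fst \<tau>snd(3) by (simp add: y_le)
    next
      case False
      then show ?thesis using drawing_vertex[OF d g] by (simp add: y_gt)
    qed
    show "(i = fst g \<or> i = snd g) \<and> (i = fst h \<or> i = snd h)"
      if g: "g \<in> E" "h \<in> E" "g \<noteq> h" "fst g \<le> i" "i \<le> snd g" "fst h \<le> i" "i \<le> snd h" "?y g i = ?y h i"
      for g h i
    proof (cases "i \<le> k")
      case True
      then show ?thesis
        using drawing_distinct[OF d, of "\<tau> g" "\<tau> h" i] g by (simp add: y_le \<tau>E \<tau>inj \<tau>fst \<tau>snd)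
    next
      case False
      then show ?thesis using drawing_distinct[OF d g(1-7)] g(8) by (simp add: y_gt)
    qed
  qed
  \<comment> \<open>At column \<open>k\<close> the new drawing has the swapped heights, at
    \<open>k + 1\<close> the original ones. This gap is the only place where new crossings are not
    simply relabelled old ones.\<close>
  define N where "N = (\<lambda>p q. (p, q, k) \<in> crossings E ?y)"
  have N: "p \<in> E" "q \<in> E" "fst p \<le> k" "k < snd p" "fst q \<le> k" "k < snd q"
    "y (\<tau> p) k < y (\<tau> q) k" "y q (k + 1) < y p (k + 1)" if "N p q" for p q
    using that unfolding N_def crossings_def by (auto simp: y_le y_gt)
  have Ne: "y f k < y q k \<and> q \<noteq> e \<and> q \<noteq> f" if "N e q" for q
  proof -
    have "q \<noteq> e" "q \<noteq> f" using N(7,8)[OF that] ef ne unfolding \<tau>_def by (auto split: if_splits)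
    then show ?thesis using N(7)[OF that] ne unfolding \<tau>_def by simp
  qed
  have Nf: "y e k < y q k \<and> q \<noteq> e \<and> q \<noteq> f" if "N f q" for q
  proof -
    have "q \<noteq> e" "q \<noteq> f" using N(7,8)[OF that] ef ne unfolding \<tau>_def by (auto split: if_splits)
    then show ?thesis using N(7)[OF that] ne unfolding \<tau>_def by simp
  qed
  have eN: "y p k < y f k \<and> p \<noteq> e \<and> p \<noteq> f" if "N p e" for p
  proof -
    have "p \<noteq> e" "p \<noteq> f" using N(7,8)[OF that] ef ne unfolding \<tau>_def by (auto split: if_splits)
    then show ?thesis using N(7)[OF that] ne unfolding \<tau>_def by simp
  qed
  have fN: "y p k < y e k \<and> p \<noteq> e \<and> p \<noteq> f" if "N p f" for p
  proof -
    have "p \<noteq> e" "p \<noteq> f" using N(7,8)[OF that] ef ne unfolding \<tau>_def by (auto split: if_splits)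
    then show ?thesis using N(7)[OF that] ne unfolding \<tau>_def by simp
  qed
  define G where "G = (\<lambda>p q. if p = f \<and> y q k \<le> y f k then (e, q)
    else if q = e \<and> y e k \<le> y p k then (p, f) else (p, q))"
  define h where "h = (\<lambda>(p, q, i). if i < k then (\<tau> p, \<tau> q, i) else if k < i then (p, q, i)
    else (fst (G p q), snd (G p q), i))"
  have "h ` crossings E ?y \<subseteq> crossings E y - {(e, f, k)}"
  proof (rule image_subsetI)
    fix x assume x: "x \<in> crossings E ?y"
    obtain p q i where xeq: "x = (p, q, i)" by (cases x)
    consider "i < k" | "k < i" | "i = k" by linarith
    then show "h x \<in> crossings E y - {(e, f, k)}"
    proof cases
      case 1
      then have "i + 1 \<le> k" "i \<le> k" by auto
      then show ?thesis using x 1 unfolding xeq h_def crossings_def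
        by (auto simp: y_le \<tau>E \<tau>fst \<tau>snd)
    next
      case 2
      then show ?thesis using x unfolding xeq h_def crossings_def by (auto simp: y_gt)
    next
      case 3
      then have n: "N p q" using x unfolding xeq N_def by simp
      note n' = N[OF n]
      have "p \<in> E \<Longrightarrow> q \<in> E \<Longrightarrow> fst p \<le> k \<Longrightarrow> k < snd p \<Longrightarrow> fst q \<le> k \<Longrightarrow> k < snd q \<Longrightarrow> y p k < y q k
        \<Longrightarrow> y q (k + 1) < y p (k + 1) \<Longrightarrow> (p, q, k) \<in> crossings E y" for p q
        unfolding crossings_def by simp
      note cI = this
      have fk: "fst f \<le> k" using ef lef by simp
      consider "p = e" | "p = f" | "p \<noteq> e" "p \<noteq> f" "q = e" | "p \<noteq> e" "p \<noteq> f" "q = f"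
        | "p \<noteq> e" "p \<noteq> f" "q \<noteq> e" "q \<noteq> f" by blast
      then show ?thesis
      proof cases
        case 1
        then have g: "G p q = (e, q)" "q \<noteq> f" using Ne n ne unfolding G_def by auto
        have "(e, q, k) \<in> crossings E y"
          by (rule cI) (use n' ef Ne[of q] n 1 in auto)
        then show ?thesis using g unfolding xeq h_def 3 by simp
      next
        case 2
        then have q: "y e k < y q k" "q \<noteq> e" "q \<noteq> f" using Nf n by auto
        show ?thesis
        proof (cases "y q k \<le> y f k")
          case True
          then have g: "G p q = (e, q)" using 2 unfolding G_def by auto
          have "(e, q, k) \<in> crossings E y"
            by (rule cI) (use n' ef q 2 in auto)
          then show ?thesis using g q unfolding xeq h_def 3 by simp
        next
          case False
          then have g: "G p q = (f, q)" using 2 q unfolding G_def by auto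
          have "(f, q, k) \<in> crossings E y"
            by (rule cI) (use n' ef q 2 False fk in auto)
          then show ?thesis using g q ne unfolding xeq h_def 3 by simp
        qed
      next
        case p: 3
        then have q: "y p k < y f k" using eN n by auto
        show ?thesis
        proof (cases "y e k \<le> y p k")
          case True
          then have g: "G p q = (p, f)" using p unfolding G_def by auto
          have "(p, f, k) \<in> crossings E y"
            by (rule cI) (use n' ef q p fk in auto)
          then show ?thesis using g p unfolding xeq h_def 3 by simp
        next
          case False
          then have g: "G p q = (p, e)" using p q unfolding G_def by auto
          have "(p, e, k) \<in> crossings E y"
            by (rule cI) (use n' ef q p False in auto)
          then show ?thesis using g p ne unfolding xeq h_def 3 by simp
        qed
      next
        case p: 4
        then have q: "y p k < y e k" using fN n by auto
        have g: "G p q = (p, f)" using p ne unfolding G_def by auto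
        have "(p, f, k) \<in> crossings E y"
          by (rule cI) (use n' ef q p fk in auto)
        then show ?thesis using g p unfolding xeq h_def 3 by simp
      next
        case p: 5
        have g: "G p q = (p, q)" using p unfolding G_def by auto
        have "(p, q, k) \<in> crossings E y"
          by (rule cI) (use n' p in \<open>auto simp: \<tau>_def\<close>)
        then show ?thesis using g p unfolding xeq h_def 3 by simp
      qed
    qed
  qed
  moreover have "inj_on h (crossings E ?y)"
  proof (rule inj_onI)
    fix x x' assume x: "x \<in> crossings E ?y" "x' \<in> crossings E ?y" "h x = h x'"
    obtain p q i p' q' i' where xeq: "x = (p, q, i)" "x' = (p', q', i')" by (cases x, cases x')
    have i: "i' = i" using x(3) unfolding xeq h_def by (auto split: if_splits)
    show "x = x'"
    proof (cases "i = k")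
      case False
      then show ?thesis using x(3) unfolding xeq h_def i by (auto simp: \<tau>inj split: if_splits)
    next
      case True
      then have n: "N p q" "N p' q'" using x unfolding xeq N_def i by auto
      have g: "G p q = G p' q'" using x(3) unfolding xeq h_def i True by (auto simp: prod_eq_iff)
      \<comment> \<open>A crossing redirected from \<open>f\<close> to \<open>e\<close> has
        \<open>y q k \<le> y f k\<close>, whereas a new crossing that \<open>e\<close> itself has
        with \<open>q\<close> satisfies \<open>y f k < y q k\<close>; the case of an edge crossing
        from below is dual. Hence the images stay apart.\<close>
      have "p = p' \<and> q = q'"
        using g Ne[of q] Ne[of q'] Nf[of q] Nf[of q'] eN[of p] eN[of p'] fN[of p] fN[of p'] n
        unfolding G_def by (auto split: if_splits)
      then show ?thesis unfolding xeq i by simp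
    qed
  qed
  ultimately have "card (crossings E ?y) \<le> card (crossings E y - {(e, f, k)})"
    using card_inj_on_le finite_crossings[OF d] by blast
  then show "card (crossings E ?y) < card (crossings E y)"
    using card_Diff1_less[OF finite_crossings[OF d] c] by linarith
qed

lemma uncross_right:
  assumes d: "drawing V E Y y" and c: "(e, f, k) \<in> crossings E y" and ref: "snd e = snd f"
  shows "\<exists>y'. drawing V E Y y' \<and> card (crossings E y') < card (crossings E y)"
proof -
  let ?m = "\<lambda>e::int \<times> int. (- snd e, - fst e)"
  let ?s = "swap_prefix (?m f) (?m e) (- k - 1) (mirror_heights y)"
  have "(?m f, ?m e, - k - 1) \<in> crossings (mirror_edges E) (mirror_heights y)"
    using c by (simp add: crossings_mirror)
  from uncross_left[OF drawing_mirror[OF d] this]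
  have s: "drawing (uminus ` V) (mirror_edges E) (\<lambda>i. Y (- i)) ?s"
    "card (crossings (mirror_edges E) ?s) < card (crossings (mirror_edges E) (mirror_heights y))"
    using ref by auto
  have "drawing V E Y (mirror_heights ?s)"
    using drawing_mirror[OF s(1)] by (simp add: image_comp comp_def)
  moreover have "card (crossings E (mirror_heights ?s)) < card (crossings E y)"
    using s(2) card_crossings_mirror[of "mirror_edges E" ?s] by (simp add: card_crossings_mirror)
  ultimately show ?thesis by blast
qed

text \<open>Removing one crossing of adjacent edges may create others, but the total number of
  crossings drops, so the process ends.\<close>

lemma uncross_adjacent:
  assumes "drawing V E Y y"
  shows "\<exists>y'. drawing V E Y y' \<and> card (crossings E y') \<le> card (crossings E y) \<and>
    (\<forall>(e, f, i) \<in> crossings E y'. fst e \<noteq> fst f \<and> snd e \<noteq> snd f)"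
  using assms
proof (induction "card (crossings E y)" arbitrary: y rule: less_induct)
  case less
  show ?case
  proof (cases "\<forall>(e, f, i) \<in> crossings E y. fst e \<noteq> fst f \<and> snd e \<noteq> snd f")
    case True
    then show ?thesis using less.prems by blast
  next
    case False
    then obtain e f k where c: "(e, f, k) \<in> crossings E y" "fst e = fst f \<or> snd e = snd f" by blast
    then obtain y1 where y1: "drawing V E Y y1" "card (crossings E y1) < card (crossings E y)"
      using uncross_left[OF less.prems c(1)] uncross_right[OF less.prems c(1)] by blast
    show ?thesis using less.hyps[OF y1(2,1)] y1(2) by (meson le_less_trans less_imp_le)
  qed
qed

section \<open>Averaging over the colourings of the vertices\<close>

text \<open>One colour is chosen for \<open>A\<close> and one for each vertex outside it. The factor
  \<open>t ^ card A\<close> expresses the probability without division, and \<open>PiE\<close> fixes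
  the values outside \<open>V\<close> so that colourings can be counted.\<close>

lemma card_constant_colourings:
  assumes "finite V" "A \<subseteq> V" "a \<in> A"
  shows "card {c \<in> PiE V (\<lambda>_. {..<t::nat}). \<forall>x\<in>A. c x = c a} * t ^ card A = t * t ^ card V"
proof -
  let ?S = "{c \<in> PiE V (\<lambda>_. {..<t}). \<forall>x\<in>A. c x = c a}"
  let ?W = "insert a (V - A)"
  have "bij_betw (\<lambda>c. restrict c ?W) ?S (PiE ?W (\<lambda>_. {..<t}))"
  proof (rule bij_betw_byWitness[where f' = "\<lambda>g. restrict (\<lambda>x. if x \<in> A then g a else g x) V"])
    show "\<forall>c\<in>?S. restrict (\<lambda>x. if x \<in> A then restrict c ?W a else restrict c ?W x) V = c"
    proof (intro ballI ext)
      fix c x assume c: "c \<in> ?S"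
      show "restrict (\<lambda>x. if x \<in> A then restrict c ?W a else restrict c ?W x) V x = c x"
      proof (cases "x \<in> V")
        case True
        then show ?thesis using c by (simp add: restrict_def)
      next
        case False
        then have "c x = undefined" using c by (auto intro: PiE_arb)
        then show ?thesis using False by simp
      qed
    qed
    show "\<forall>g\<in>PiE ?W (\<lambda>_. {..<t}). restrict (restrict (\<lambda>x. if x \<in> A then g a else g x) V) ?W = g"
    proof (intro ballI ext)
      fix g x assume g: "g \<in> PiE ?W (\<lambda>_. {..<t})"
      show "restrict (restrict (\<lambda>x. if x \<in> A then g a else g x) V) ?W x = g x"
      proof (cases "x \<in> ?W")
        case True
        then show ?thesis using assms(2,3) by (auto simp: restrict_def)
      next
        case False
        then have "g x = undefined" using g by (rule PiE_arb[rotated])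
        then show ?thesis using False by simp
      qed
    qed
    show "(\<lambda>c. restrict c ?W) ` ?S \<subseteq> PiE ?W (\<lambda>_. {..<t})"
    proof (rule image_subsetI)
      fix c assume "c \<in> ?S"
      then have "\<And>x. x \<in> V \<Longrightarrow> c x \<in> {..<t}" by (auto dest: PiE_mem)
      then show "restrict c ?W \<in> PiE ?W (\<lambda>_. {..<t})"
        using assms(2,3) by (intro restrict_PiE_iff[THEN iffD2]) blast
    qed
    show "(\<lambda>g. restrict (\<lambda>x. if x \<in> A then g a else g x) V) ` PiE ?W (\<lambda>_. {..<t}) \<subseteq> ?S"
    proof (rule image_subsetI)
      fix g assume g: "g \<in> PiE ?W (\<lambda>_. {..<t})"
      have "g x \<in> {..<t}" if "x \<in> V - A \<or> x = a" for x using PiE_mem[OF g, of x] that by blast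
      then have "restrict (\<lambda>x. if x \<in> A then g a else g x) V \<in> PiE V (\<lambda>_. {..<t})"
        by (intro restrict_PiE_iff[THEN iffD2]) auto
      moreover have "\<forall>x\<in>A. restrict (\<lambda>x. if x \<in> A then g a else g x) V x
          = restrict (\<lambda>x. if x \<in> A then g a else g x) V a"
        using assms(2,3) by (auto simp: restrict_def)
      ultimately show "restrict (\<lambda>x. if x \<in> A then g a else g x) V \<in> ?S" by simp
    qed
  qed
  then have "card ?S = card (PiE ?W (\<lambda>_. {..<t}))" by (rule bij_betw_same_card)
  also have "\<dots> = t ^ card ?W" using assms by (subst card_PiE) auto
  also have "card ?W = Suc (card (V - A))" using assms by (subst card_insert_disjoint) auto
  finally have "card ?S * t ^ card A = t * t ^ (card (V - A) + card A)" by (simp add: power_add)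
  moreover have "card (V - A) + card A = card V"
    using assms by (metis add.commute card_Diff_subset card_mono finite_subset le_add_diff_inverse)
  ultimately show ?thesis by simp
qed

lemma sum_card_filter_swap:
  assumes "finite A" "finite B"
  shows "(\<Sum>a\<in>A. card {b \<in> B. P a b}) = (\<Sum>b\<in>B. card {a \<in> A. P a b})"
proof -
  have "(\<Sum>a\<in>A. card {b \<in> B. P a b}) = (\<Sum>a\<in>A. \<Sum>b\<in>B. if P a b then 1 else 0)"
    using assms by (intro sum.cong) (simp_all flip: sum.inter_filter)
  also have "\<dots> = (\<Sum>b\<in>B. \<Sum>a\<in>A. if P a b then 1 else 0)" by (rule sum.swap)
  also have "\<dots> = (\<Sum>b\<in>B. card {a \<in> A. P a b})"
    using assms by (intro sum.cong) (simp_all flip: sum.inter_filter)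
  finally show ?thesis .
qed

lemma card_eq_sum_fibres:
  assumes "finite A" "finite T" "g ` A \<subseteq> T"
  shows "card A = (\<Sum>j\<in>T. card {x \<in> A. g x = j})"
  using sum.group[OF assms, of "\<lambda>_. 1 :: nat"] by simp

text \<open>Each colour class carries a drawing of its own, to which the linear bound applies. The
  classes partition the vertices, so the term \<open>3 * card V\<close> appears once rather than
  once per colour.\<close>

lemma monochromatic_edges_le:
  assumes d: "drawing V E Y y" and c: "c \<in> PiE V (\<lambda>_. {..<t::nat})"
  shows "card {e \<in> E. c (snd e) = c (fst e)} \<le> 3 * card V +
    card {x \<in> crossings E y. case x of (e, f, i) \<Rightarrow> c (snd e) = c (fst e) \<and> c (fst f) = c (fst e) \<and> c (snd f) = c (fst e)}"
    (is "card ?E \<le> 3 * card V + card ?X")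
proof -
  have fin: "finite V" "finite E" using drawing_finite[OF d] by auto
  have EV: "fst e \<in> V" "snd e \<in> V" if "e \<in> E" for e using drawing_edge[OF d that] by auto
  have cV: "c v < t" if "v \<in> V" for v using c that by auto
  let ?Ej = "\<lambda>j. {e \<in> ?E. c (fst e) = j}" and ?Vj = "\<lambda>j. {v \<in> V. c v = j}"
  let ?Xj = "\<lambda>j. {x \<in> ?X. c (fst (fst x)) = j}"
  have j: "card (?Ej j) \<le> 3 * card (?Vj j) + card (?Xj j)" for j
  proof -
    have "drawing (?Vj j) (?Ej j) Y y"
      by (rule drawing_subgraph[OF d]) (use EV in \<open>force+\<close>)
    then have "card (?Ej j) \<le> 3 * card (?Vj j) + card (crossings (?Ej j) y)"
      by (rule card_edges_le_crossings)
    moreover have "crossings (?Ej j) y = ?Xj j"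
      unfolding crossings_def by auto
    ultimately show ?thesis by simp
  qed
  have "card ?E = (\<Sum>j<t. card (?Ej j))"
    by (rule card_eq_sum_fibres) (use fin EV cV in auto)
  also have "\<dots> \<le> (\<Sum>j<t. 3 * card (?Vj j) + card (?Xj j))"
    by (rule sum_mono) (rule j)
  also have "\<dots> = 3 * (\<Sum>j<t. card (?Vj j)) + (\<Sum>j<t. card (?Xj j))"
    by (simp add: sum.distrib sum_distrib_left)
  also have "(\<Sum>j<t. card (?Vj j)) = card V"
    by (rule card_eq_sum_fibres[symmetric]) (use fin cV in auto)
  also have "(\<Sum>j<t. card (?Xj j)) = card ?X"
  proof (rule card_eq_sum_fibres[symmetric])
    show "finite ?X" using finite_crossings[OF d] by simp
    show "(\<lambda>x. c (fst (fst x))) ` ?X \<subseteq> {..<t}" using EV cV unfolding crossings_def by auto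
  qed simp
  finally show ?thesis .
qed

text \<open>Average over all colourings of the vertices with \<open>t\<close> colours, applying the linear bound within each colour
  class. Once crossings of edges with a common end have been removed, a crossing involves four distinct
  vertices and is monochromatic with probability \<open>t\<^sup>-\<^sup>3\<close>, an edge with probability \<open>t\<^sup>-\<^sup>1\<close>.\<close>

lemma crossing_lemma:
  assumes d0: "drawing V E Y y0" and t: "t \<ge> (1::nat)"
  shows "t ^ 2 * card E \<le> 3 * t ^ 3 * card V + card (crossings E y0)"
proof -
  obtain y where d: "drawing V E Y y" and le: "card (crossings E y) \<le> card (crossings E y0)"
    and nadj: "\<And>e f i. (e, f, i) \<in> crossings E y \<Longrightarrow> fst e \<noteq> fst f \<and> snd e \<noteq> snd f"
    using uncross_adjacent[OF d0] by blast
  have fin: "finite V" "finite E" using drawing_finite[OF d] by auto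
  define C where "C = PiE V (\<lambda>_. {..<t})"
  define T where "T = t ^ card V"
  have finC: "finite C" unfolding C_def using fin by (simp add: finite_PiE)
  have cardC: "card C = T" unfolding C_def T_def using fin by (subst card_PiE) auto
  let ?P = "\<lambda>c e. c (snd e) = c (fst e)"
  let ?Q = "\<lambda>c x. case x of (e, f, i) \<Rightarrow> c (snd e) = c (fst e) \<and> c (fst f) = c (fst e) \<and> c (snd f) = c (fst e)"
  have edge: "card {c \<in> C. ?P c e} * t = T" if e: "e \<in> E" for e
  proof -
    note e' = drawing_edge[OF d e]
    have "card {c \<in> C. \<forall>x\<in>{fst e, snd e}. c x = c (fst e)} * t ^ card {fst e, snd e} = t * T"
      unfolding C_def T_def by (rule card_constant_colourings) (use fin e' in auto)
    moreover have "card {fst e, snd e} = 2" using e' by simp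
    ultimately show ?thesis using t by (simp add: power2_eq_square)
  qed
  have cross: "card {c \<in> C. ?Q c x} * t ^ 3 = T" if x: "x \<in> crossings E y" for x
  proof -
    obtain e f i where xe: "x = (e, f, i)" by (cases x)
    have ef: "e \<in> E" "f \<in> E" "fst e \<le> i" "i < snd e" "fst f \<le> i" "i < snd f"
      using x unfolding xe crossings_def by auto
    note e' = drawing_edge[OF d ef(1)] and f' = drawing_edge[OF d ef(2)]
    let ?A = "{fst e, snd e, fst f, snd f}"
    have "card {c \<in> C. \<forall>x\<in>?A. c x = c (fst e)} * t ^ card ?A = t * T"
      unfolding C_def T_def by (rule card_constant_colourings) (use fin e' f' in auto)
    \<comment> \<open>Common left ends and common right ends were removed by uncrossing. A left end
      of one edge cannot be the right end of the other, since both edges span the gap from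
      \<open>i\<close> to \<open>i + 1\<close>.\<close>
    moreover have "card ?A = 4" using e' f' ef nadj[of e f i] x unfolding xe by auto
    moreover have "{c \<in> C. \<forall>x\<in>?A. c x = c (fst e)} = {c \<in> C. ?Q c x}" unfolding xe by auto
    ultimately show ?thesis using t by (simp add: power4_eq_xxxx power3_eq_cube)
  qed
  have "(\<Sum>e\<in>E. card {c \<in> C. ?P c e}) = (\<Sum>c\<in>C. card {e \<in> E. ?P c e})"
    by (rule sum_card_filter_swap[OF fin(2) finC])
  also have "\<dots> \<le> (\<Sum>c\<in>C. 3 * card V + card {x \<in> crossings E y. ?Q c x})"
    by (rule sum_mono) (rule monochromatic_edges_le[OF d], simp add: C_def)
  also have "\<dots> = 3 * card V * T + (\<Sum>x\<in>crossings E y. card {c \<in> C. ?Q c x})"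
    by (simp add: sum.distrib cardC sum_card_filter_swap[OF finC finite_crossings[OF d]])
  \<comment> \<open>Multiplication by \<open>t ^ 3\<close> clears the denominators of both
    probabilities, so the averaging stays within the natural numbers.\<close>
  finally have "(\<Sum>e\<in>E. card {c \<in> C. ?P c e}) * t ^ 3
      \<le> (3 * card V * T + (\<Sum>x\<in>crossings E y. card {c \<in> C. ?Q c x})) * t ^ 3"
    by (rule mult_right_mono) simp
  also have "\<dots> = 3 * card V * T * t ^ 3 + (\<Sum>x\<in>crossings E y. card {c \<in> C. ?Q c x} * t ^ 3)"
    by (simp add: add_mult_distrib sum_distrib_right)
  also have "\<dots> = 3 * card V * T * t ^ 3 + card (crossings E y) * T"
    using cross by simp
  also have "(\<Sum>e\<in>E. card {c \<in> C. ?P c e}) * t ^ 3 = (\<Sum>e\<in>E. (card {c \<in> C. ?P c e} * t) * t ^ 2)"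
    by (simp add: sum_distrib_right power2_eq_square power3_eq_cube mult.assoc)
  also have "\<dots> = card E * (T * t ^ 2)"
    using edge by simp
  finally have "T * (t ^ 2 * card E) \<le> T * (3 * t ^ 3 * card V + card (crossings E y))"
    by (simp add: algebra_simps)
  moreover have "T > 0" unfolding T_def using t by simp
  ultimately have "t ^ 2 * card E \<le> 3 * t ^ 3 * card V + card (crossings E y)" by simp
  then show ?thesis using le by linarith
qed

section \<open>Arcs of circles\<close>

lemma dist_vec2: "dist (a::real^2) b = sqrt ((a $ 1 - b $ 1)\<^sup>2 + (a $ 2 - b $ 2)\<^sup>2)"
  by (simp add: dist_vec_def L2_set_def sum_2 dist_real_def)

lemma dist_vec2_eq: "dist (a::real^2) b = d \<longleftrightarrow> 0 \<le> d \<and> (a $ 1 - b $ 1)\<^sup>2 + (a $ 2 - b $ 2)\<^sup>2 = d\<^sup>2"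
  unfolding dist_vec2 by (metis real_sqrt_abs abs_of_nonneg real_sqrt_ge_zero real_sqrt_pow2 sum_power2_ge_zero)

lemma vec2_eq_iff: "(a::real^2) = b \<longleftrightarrow> a $ 1 = b $ 1 \<and> a $ 2 = b $ 2"
  by (simp add: vec_eq_iff forall_2)

lemma card_le_2I:
  assumes "\<And>p q w. p \<in> S \<Longrightarrow> q \<in> S \<Longrightarrow> w \<in> S \<Longrightarrow> p \<noteq> q \<Longrightarrow> w \<noteq> q \<Longrightarrow> p = w"
  shows "finite S \<and> card S \<le> 2"
proof (cases "\<exists>p q. p \<in> S \<and> q \<in> S \<and> p \<noteq> q")
  case True
  then obtain p q where pq: "p \<in> S" "q \<in> S" "p \<noteq> q" by blast
  then have "S \<subseteq> {p, q}" using assms by blast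
  moreover have "card {p, q} \<le> 2" using pq by simp
  ultimately show ?thesis by (meson card_mono finite.emptyI finite.insertI finite_subset le_trans)
next
  case False
  then have "S = {} \<or> (\<exists>p. S = {p})" by blast
  then show ?thesis by auto
qed

lemma quadratic_second_root:
  fixes x y v w s :: real
  assumes "(x - s * w)\<^sup>2 + (y + s * v)\<^sup>2 = x\<^sup>2 + y\<^sup>2" "s \<noteq> 0"
  shows "s * (v\<^sup>2 + w\<^sup>2) = 2 * (x * w - y * v)"
proof -
  have "s * (s * (v\<^sup>2 + w\<^sup>2) - 2 * (x * w - y * v)) = 0"
    using assms(1) by (simp add: power2_eq_square algebra_simps)
  then show ?thesis using assms(2) by simp
qed

lemma orthogonal_vec2:
  fixes x y v w :: real
  assumes "v * x + w * y = 0" "v \<noteq> 0 \<or> w \<noteq> 0"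
  shows "\<exists>s. x = - s * w \<and> y = s * v"
proof (cases "v = 0")
  case True
  then show ?thesis using assms by (intro exI[of _ "- x / w"]) auto
next
  case False
  then show ?thesis using assms(1) by (intro exI[of _ "y / v"]) (simp add: field_simps eq_neg_iff_add_eq_0)
qed

text \<open>Subtracting the two equations puts the common points on a line perpendicular to
  \<open>a' - a\<close>. Seen from one common point \<open>q\<close>, any other has a parameter
  \<open>s\<close> that is the nonzero root of a quadratic vanishing at 0, hence unique.\<close>

lemma circle_inter:
  fixes a a' :: "real^2"
  assumes "a \<noteq> a'"
  shows "finite {p. dist a p = d \<and> dist a' p = d'} \<and> card {p. dist a p = d \<and> dist a' p = d'} \<le> 2"
proof (rule card_le_2I)
  define v w where "v = a' $ 1 - a $ 1" and "w = a' $ 2 - a $ 2"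
  have vw: "v \<noteq> 0 \<or> w \<noteq> 0" using assms unfolding v_def w_def vec2_eq_iff by auto
  have key: "\<exists>s. p $ 1 = q $ 1 - s * w \<and> p $ 2 = q $ 2 + s * v \<and>
      s * (v\<^sup>2 + w\<^sup>2) = 2 * ((q $ 1 - a $ 1) * w - (q $ 2 - a $ 2) * v)"
    if p: "p \<in> {p. dist a p = d \<and> dist a' p = d'}" and q: "q \<in> {p. dist a p = d \<and> dist a' p = d'}" and ne: "p \<noteq> q" for p q
  proof -
    have 1: "(a $ 1 - p $ 1)\<^sup>2 + (a $ 2 - p $ 2)\<^sup>2 = (a $ 1 - q $ 1)\<^sup>2 + (a $ 2 - q $ 2)\<^sup>2"
      "(a' $ 1 - p $ 1)\<^sup>2 + (a' $ 2 - p $ 2)\<^sup>2 = (a' $ 1 - q $ 1)\<^sup>2 + (a' $ 2 - q $ 2)\<^sup>2"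
      using p q by (auto simp: dist_vec2_eq)
    then have "v * (p $ 1 - q $ 1) + w * (p $ 2 - q $ 2) = 0"
      unfolding v_def w_def by (simp add: power2_eq_square algebra_simps)
    from orthogonal_vec2[OF this vw] obtain s where s: "p $ 1 - q $ 1 = - s * w" "p $ 2 - q $ 2 = s * v" by blast
    then have s0: "s \<noteq> 0" using ne unfolding vec2_eq_iff by auto
    have p': "p $ 1 = q $ 1 - s * w" "p $ 2 = q $ 2 + s * v" using s by auto
    have "((q $ 1 - a $ 1) - s * w)\<^sup>2 + ((q $ 2 - a $ 2) + s * v)\<^sup>2 = (q $ 1 - a $ 1)\<^sup>2 + (q $ 2 - a $ 2)\<^sup>2"
      using 1(1) unfolding p' by (simp add: power2_eq_square algebra_simps)
    from quadratic_second_root[OF this s0] show ?thesis using p' by blast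
  qed
  fix p q u assume *: "p \<in> {p. dist a p = d \<and> dist a' p = d'}" "q \<in> {p. dist a p = d \<and> dist a' p = d'}"
    "u \<in> {p. dist a p = d \<and> dist a' p = d'}" "p \<noteq> q" "u \<noteq> q"
  obtain s where s: "p $ 1 = q $ 1 - s * w" "p $ 2 = q $ 2 + s * v"
      "s * (v\<^sup>2 + w\<^sup>2) = 2 * ((q $ 1 - a $ 1) * w - (q $ 2 - a $ 2) * v)" using key[OF *(1,2,4)] by blast
  obtain s' where s': "u $ 1 = q $ 1 - s' * w" "u $ 2 = q $ 2 + s' * v"
      "s' * (v\<^sup>2 + w\<^sup>2) = 2 * ((q $ 1 - a $ 1) * w - (q $ 2 - a $ 2) * v)" using key[OF *(3,2,5)] by blast
  have "v\<^sup>2 + w\<^sup>2 \<noteq> 0" using vw by (simp add: sum_power2_eq_zero_iff)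
  then have "s = s'" using s(3) s'(3) by (metis mult_cancel_right)
  then show "p = u" using s s' unfolding vec2_eq_iff by simp
qed

lemma ex_generic_direction:
  fixes S :: "(real^2) set"
  assumes "finite S"
  shows "\<exists>s. inj_on (\<lambda>p. p $ 1 + s * p $ 2) S"
proof -
  \<comment> \<open>Pairs with equal second coordinates contribute only the value 0 of a division by
    zero, which excludes at most one further \<open>s\<close>.\<close>
  define B where "B = (\<lambda>(p, q). - (p $ 1 - q $ 1) / (p $ 2 - q $ 2)) ` (S \<times> S)"
  have "finite B" unfolding B_def using assms by simp
  then obtain s where s: "s \<notin> B" using ex_new_if_finite[OF infinite_UNIV_char_0] by blast
  have "inj_on (\<lambda>p. p $ 1 + s * p $ 2) S"
  proof (rule inj_onI)
    fix p q assume pq: "p \<in> S" "q \<in> S" "p $ 1 + s * p $ 2 = q $ 1 + s * q $ 2"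
    show "p = q"
    proof (cases "p $ 2 = q $ 2")
      case True
      then show ?thesis using pq unfolding vec2_eq_iff by simp
    next
      case False
      then have "s = - (p $ 1 - q $ 1) / (p $ 2 - q $ 2)" using pq(3) by (simp add: field_simps)
      then have "s \<in> B" unfolding B_def using pq by force
      then show ?thesis using s by simp
    qed
  qed
  then show ?thesis ..
qed

lemma ex_increasing_enumeration:
  fixes x :: "'a \<Rightarrow> real"
  assumes fin: "finite Q" and inj: "inj_on x Q"
  shows "\<exists>b. bij_betw b {0..<int (card Q)} Q \<and>
    (\<forall>i j. 0 \<le> i \<and> i < j \<and> j < int (card Q) \<longrightarrow> x (b i) < x (b j))"
proof -
  define L where "L = sorted_list_of_set (x ` Q)"
  have L: "sorted L" "distinct L" "set L = x ` Q" "length L = card Q"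
    unfolding L_def using fin inj by (simp_all add: card_image)
  define b where "b = (\<lambda>i. the_inv_into Q x (L ! nat i))"
  have xb: "b i \<in> Q \<and> x (b i) = L ! nat i" if "0 \<le> i" "i < int (card Q)" for i
  proof -
    have "nat i < length L" using that L by linarith
    then have "L ! nat i \<in> x ` Q" using L(3) nth_mem by blast
    then show ?thesis unfolding b_def
      using f_the_inv_into_f[OF inj] the_inv_into_into[OF inj _ order_refl] by blast
  qed
  have mono: "x (b i) < x (b j)" if "0 \<le> i" "i < j" "j < int (card Q)" for i j
  proof -
    have "nat i < nat j" "nat j < length L" using that L by auto
    then have "L ! nat i < L ! nat j"
      using L(1,2) sorted_wrt_nth_less[of "(<)" L] strict_sorted_iff by blast
    then show ?thesis using xb[of i] xb[of j] that by simp
  qed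
  have "inj_on b {0..<int (card Q)}"
  proof (rule inj_onI)
    fix i j assume "i \<in> {0..<int (card Q)}" "j \<in> {0..<int (card Q)}" "b i = b j"
    then show "i = j" using mono[of i j] mono[of j i] by (cases i j rule: linorder_cases) auto
  qed
  moreover have sub: "b ` {0..<int (card Q)} \<subseteq> Q" using xb by auto
  moreover have "b ` {0..<int (card Q)} = Q"
    by (rule card_subset_eq[OF fin sub]) (simp add: card_image calculation(1))
  ultimately show ?thesis using mono unfolding bij_betw_def by blast
qed

section \<open>Semicircles as graphs of functions of the abscissa\<close>

definition semicircle :: "(real^2) \<times> real \<times> bool \<Rightarrow> real \<Rightarrow> real"
  where "semicircle c x = (fst c) $ 2 +
    (if snd (snd c) then 1 else - 1) * sqrt ((fst (snd c))\<^sup>2 - (x - (fst c) $ 1)\<^sup>2)"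

text \<open>Points at the height of the centre are assigned to the upper half, so every pair of a
  centre and a point determines exactly one semicircle.\<close>

definition semicircle_through :: "real^2 \<Rightarrow> real^2 \<Rightarrow> (real^2) \<times> real \<times> bool"
  where "semicircle_through a p = (a, dist a p, p $ 2 \<ge> a $ 2)"

text \<open>The square root is extended to negative reals as an odd function and is continuous
  everywhere, so \<open>S\<close> need not lie over the circle.\<close>

lemma continuous_semicircle: "continuous_on S (semicircle c)"
  unfolding semicircle_def by (intro continuous_intros)

lemma semicircle_through_eval: "semicircle (semicircle_through a p) (p $ 1) = p $ 2"
proof -
  have "(dist a p)\<^sup>2 - (p $ 1 - a $ 1)\<^sup>2 = (p $ 2 - a $ 2)\<^sup>2"
    unfolding dist_vec2 by (simp add: power2_commute)
  then show ?thesis unfolding semicircle_def semicircle_through_def by auto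
qed

lemma abs_through_le: "\<bar>p $ 1 - a $ 1\<bar> \<le> dist a p" for a p :: "real^2"
  using component_le_norm_cart[of "a - p" 1] by (simp add: dist_norm abs_minus_commute)

lemma semicircle_point_dist:
  assumes "\<bar>x - (fst c) $ 1\<bar> \<le> fst (snd c)"
  shows "dist (fst c) (vector [x, semicircle c x]) = fst (snd c)"
proof -
  have "(x - (fst c) $ 1)\<^sup>2 \<le> (fst (snd c))\<^sup>2" using assms by (simp add: abs_le_square_iff[symmetric])
  then have "(sqrt ((fst (snd c))\<^sup>2 - (x - (fst c) $ 1)\<^sup>2))\<^sup>2 = (fst (snd c))\<^sup>2 - (x - (fst c) $ 1)\<^sup>2" by simp
  then show ?thesis unfolding dist_vec2_eq semicircle_def vector_2
    using assms by (auto simp: power2_eq_square algebra_simps)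
qed

text \<open>The inequality is strict because the leftmost and rightmost points of a circle lie on
  both halves but are assigned to the upper one.\<close>

lemma semicircle_through_iff:
  assumes "\<bar>p $ 1 - (fst c) $ 1\<bar> < fst (snd c)" "semicircle c (p $ 1) = p $ 2"
  shows "semicircle_through (fst c) p = c"
proof -
  have "p = vector [p $ 1, semicircle c (p $ 1)]" unfolding vec2_eq_iff vector_2 assms(2) by simp
  then have 1: "dist (fst c) p = fst (snd c)" using semicircle_point_dist[of "p $ 1" c] assms(1) by simp
  have "(p $ 1 - (fst c) $ 1)\<^sup>2 < (fst (snd c))\<^sup>2"
    using assms(1) by (metis abs_less_iff abs_of_nonneg abs_ge_zero abs_square_less_1 abs_le_square_iff not_less order_less_imp_le order_less_le_trans)
  define r where "r = sqrt ((fst (snd c))\<^sup>2 - (p $ 1 - (fst c) $ 1)\<^sup>2)"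
  have "r > 0" using \<open>(p $ 1 - (fst c) $ 1)\<^sup>2 < (fst (snd c))\<^sup>2\<close> unfolding r_def by simp
  moreover have "p $ 2 = (fst c) $ 2 + (if snd (snd c) then 1 else - 1) * r"
    using assms(2) unfolding semicircle_def r_def by simp
  ultimately have "(p $ 2 \<ge> (fst c) $ 2) = snd (snd c)" by (cases "snd (snd c)") auto
  then show ?thesis using 1 unfolding semicircle_through_def by (simp add: prod_eq_iff)
qed

section \<open>The incidence bound obtained from the crossing lemma\<close>

lemma finite_distances: "finite P \<Longrightarrow> finite Q \<Longrightarrow> finite {dist a b | a b. a \<in> P \<and> b \<in> Q}"
  by (rule finite_subset[of _ "(\<lambda>(a, b). dist a b) ` (P \<times> Q)"]) auto

text \<open>These are the possible meeting points of arcs with different centres. If they and the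
  points of \<open>Q\<close> have distinct abscissae, such arcs can meet over the column of a vertex
  only at the vertex itself.\<close>

definition circle_intersections :: "(real^2) set \<Rightarrow> (real^2) set \<Rightarrow> (real^2) set"
  where "circle_intersections P Q = {p. \<exists>a\<in>P. \<exists>a'\<in>P. \<exists>b\<in>Q. \<exists>b'\<in>Q. a \<noteq> a' \<and> dist a p = dist a b \<and> dist a' p = dist a' b'}"

lemma finite_circle_intersections:
  assumes "finite P" "finite Q"
  shows "finite (circle_intersections P Q)"
proof -
  have "circle_intersections P Q \<subseteq> (\<Union>a\<in>P. \<Union>a'\<in>P - {a}. \<Union>b\<in>Q. \<Union>b'\<in>Q. {p. dist a p = dist a b \<and> dist a' p = dist a' b'})"
    unfolding circle_intersections_def by blast
  moreover have "finite \<dots>"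
    using assms circle_inter by (intro finite_UN_I) auto
  ultimately show ?thesis by (rule finite_subset)
qed

text \<open>The vertices are the points of \<open>Q\<close>, in columns numbered by increasing abscissa; the edges are the arcs
  between consecutive points on the semicircles centred at \<open>P\<close>, one arc being kept for each pair of points.\<close>

lemma incidence_bound_generic:
  fixes P Q :: "(real^2) set"
  assumes fin: "finite P" "finite Q"
    and mult: "\<And>b b'. b \<in> Q \<Longrightarrow> b' \<in> Q \<Longrightarrow> b \<noteq> b' \<Longrightarrow> card {a \<in> P. dist a b = dist a b'} \<le> K"
    and gen: "inj_on (\<lambda>p. p $ 1) (Q \<union> circle_intersections P Q)"
    and t: "t \<ge> (1::nat)"
  shows "t\<^sup>2 * (card P * card Q) \<le> t\<^sup>2 * (2 * card P * num_distances P Q)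
    + K * (3 * t ^ 3 * card Q + 8 * (card P)\<^sup>2 * (num_distances P Q)\<^sup>2)"
proof -
  define D where "D = {dist a b | a b. a \<in> P \<and> b \<in> Q}"
  have finD: "finite D" unfolding D_def using finite_distances[OF fin] .
  have D: "num_distances P Q = card D" unfolding num_distances_def D_def ..
  define V where "V = {0..<int (card Q)}"
  have injQ: "inj_on (\<lambda>p. p $ 1) Q" using gen by (rule inj_on_subset) simp
  obtain b where b: "bij_betw b V Q" and bmono: "\<And>i j. 0 \<le> i \<Longrightarrow> i < j \<Longrightarrow> j < int (card Q) \<Longrightarrow> b i $ 1 < b j $ 1"
    using ex_increasing_enumeration[OF fin(2) injQ] unfolding V_def by blast
  have bQ: "b i \<in> Q" if "i \<in> V" for i using b that bij_betwE by blast
  define x where "x = (\<lambda>i. b i $ 1)"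
  have xmono: "x i < x j" if "i \<in> V" "j \<in> V" "i < j" for i j
    using bmono[of i j] that unfolding x_def V_def by auto
  have xmono': "x i \<le> x j" if "i \<in> V" "j \<in> V" "i \<le> j" for i j
    using xmono[of i j] that by (cases "i = j") auto
  define CC where "CC = P \<times> D \<times> (UNIV :: bool set)"
  have finCC: "finite CC" unfolding CC_def using fin finD by simp
  have cardCC: "card CC = 2 * (card P * card D)" unfolding CC_def by (simp add: card_cartesian_product)
  define S where "S = (\<lambda>c. {i \<in> V. semicircle_through (fst c) (b i) = c})"
  have finS: "finite (S c)" for c by (rule finite_subset[of _ V]) (auto simp: S_def V_def)
  define R where "R = (\<lambda>c i j. c \<in> CC \<and> i \<in> S c \<and> j \<in> S c \<and> i < j \<and> (\<forall>k\<in>S c. \<not> (i < k \<and> k < j)))"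
  define AA where "AA = {(c, i, j). R c i j}"
  have finAA: "finite AA"
  proof (rule finite_subset)
    show "AA \<subseteq> CC \<times> V \<times> V" unfolding AA_def R_def S_def by auto
    show "finite (CC \<times> V \<times> V)" using finCC unfolding V_def by simp
  qed
  define E where "E = snd ` AA"
  have finE: "finite E" unfolding E_def using finAA by simp
  have "\<forall>e\<in>E. \<exists>c. R c (fst e) (snd e)" unfolding E_def AA_def by auto
  then obtain \<kappa> where \<kappa>: "\<And>e. e \<in> E \<Longrightarrow> R (\<kappa> e) (fst e) (snd e)" by metis
  define y where "y = (\<lambda>e i. semicircle (\<kappa> e) (x i))"
  define Y where "Y = (\<lambda>i. b i $ 2)"

  have SV: "i \<in> V" if "i \<in> S c" for i c using that unfolding S_def by simp
  have on: "semicircle c (x i) = Y i" if "i \<in> S c" for i c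
    using that semicircle_through_eval[of "fst c" "b i"] unfolding S_def x_def Y_def by simp
  have absS: "\<bar>x i - fst c $ 1\<bar> \<le> fst (snd c)" if "i \<in> S c" for i c
  proof -
    have "fst (snd c) = dist (fst c) (b i)"
      using that unfolding S_def semicircle_through_def by (auto simp: prod_eq_iff)
    then show ?thesis using abs_through_le[of "b i" "fst c"] unfolding x_def by simp
  qed
  have between: "\<bar>\<xi> - fst c $ 1\<bar> \<le> fst (snd c)" if "R c i j" "x i \<le> \<xi>" "\<xi> \<le> x j" for c i j \<xi>
    using absS[of i c] absS[of j c] that unfolding R_def by auto
  have between': "\<bar>\<xi> - fst c $ 1\<bar> < fst (snd c)" if "R c i j" "x i < \<xi>" "\<xi> < x j" for c i j \<xi>
    using absS[of i c] absS[of j c] that unfolding R_def by auto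
  have avoid: "semicircle c (x z) \<noteq> Y z" if "R c i j" "z \<in> V" "i < z" "z < j" for c i j z
  proof
    assume "semicircle c (x z) = Y z"
    moreover have "i \<in> V" "j \<in> V" using that SV unfolding R_def by blast+
    then have "\<bar>x z - fst c $ 1\<bar> < fst (snd c)" using between'[OF that(1)] xmono that by blast
    ultimately have "z \<in> S c"
      using semicircle_through_iff[of "b z" c] that(2) unfolding S_def x_def Y_def by simp
    then show False using that unfolding R_def by blast
  qed
  have Runique: "i = i' \<and> j = j'" if "R c i j" "R c i' j'" "i \<le> k" "k < j" "i' \<le> k" "k < j'" for c i j i' j' k
  proof -
    have "\<not> i < i'" "\<not> i' < i" "\<not> j < j'" "\<not> j' < j" using that unfolding R_def by force+
    then show ?thesis by auto
  qed
  have eV: "fst e \<in> V" "snd e \<in> V" "fst e < snd e" if "e \<in> E" for e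
    using \<kappa>[OF that] SV[of "fst e" "\<kappa> e"] SV[of "snd e" "\<kappa> e"] unfolding R_def by auto
  have inV: "i \<in> V" if "e \<in> E" "fst e \<le> i" "i \<le> snd e" for e i
    using eV[OF that(1)] that unfolding V_def by auto
  have centre: "fst (\<kappa> e) \<in> P" "fst (snd (\<kappa> e)) \<in> D" if "e \<in> E" for e
    using \<kappa>[OF that] unfolding R_def CC_def by (auto simp: mem_Times_iff)
  \<comment> \<open>Equal centres would force equal radii, since the meeting point has only one
    distance from the centre.\<close>
  have common: "fst (\<kappa> e) \<noteq> fst (\<kappa> f) \<and> dist (fst (\<kappa> e)) p = fst (snd (\<kappa> e)) \<and> dist (fst (\<kappa> f)) p = fst (snd (\<kappa> f))"
    if e: "e \<in> E" "f \<in> E" and \<xi>: "x (fst e) \<le> \<xi>" "\<xi> \<le> x (snd e)" "x (fst f) \<le> \<xi>" "\<xi> \<le> x (snd f)"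
      and eq: "semicircle (\<kappa> e) \<xi> = semicircle (\<kappa> f) \<xi>" and ne: "(fst (\<kappa> e), fst (snd (\<kappa> e))) \<noteq> (fst (\<kappa> f), fst (snd (\<kappa> f)))"
      and p: "p = vector [\<xi>, semicircle (\<kappa> e) \<xi>]" for e f \<xi> p
  proof -
    have "dist (fst (\<kappa> e)) p = fst (snd (\<kappa> e))"
      unfolding p by (rule semicircle_point_dist[OF between[OF \<kappa>[OF e(1)] \<xi>(1,2)]])
    moreover have "dist (fst (\<kappa> f)) p = fst (snd (\<kappa> f))"
      unfolding p eq by (rule semicircle_point_dist[OF between[OF \<kappa>[OF e(2)] \<xi>(3,4)]])
    ultimately show ?thesis using ne by auto
  qed

  have dr: "drawing V E Y y"
  proof (rule drawingI)
    show "finite V" unfolding V_def by simp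
    show "E \<subseteq> V \<times> V" using eV by (auto simp: mem_Times_iff)
    show "fst e < snd e \<and> y e (fst e) = Y (fst e) \<and> y e (snd e) = Y (snd e)" if "e \<in> E" for e
      using \<kappa>[OF that] on[of "fst e" "\<kappa> e"] on[of "snd e" "\<kappa> e"] unfolding R_def y_def by auto
    show "y e z \<noteq> Y z" if "e \<in> E" "z \<in> V" "fst e < z" "z < snd e" for e z
      using avoid[OF \<kappa>[OF that(1)] that(2-4)] unfolding y_def .
    fix e f i assume ef: "e \<in> E" "f \<in> E" "e \<noteq> f" "fst e \<le> i" "i \<le> snd e" "fst f \<le> i" "i \<le> snd f"
      "y e i = y f i"
    have iV: "i \<in> V" using inV ef by blast
    have R: "R (\<kappa> e) (fst e) (snd e)" "R (\<kappa> f) (fst f) (snd f)" using \<kappa> ef by auto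
    have xi: "x (fst e) \<le> x i" "x i \<le> x (snd e)" "x (fst f) \<le> x i" "x i \<le> x (snd f)"
      using xmono' eV[OF ef(1)] eV[OF ef(2)] iV ef by auto
    show "(i = fst e \<or> i = snd e) \<and> (i = fst f \<or> i = snd f)"
    proof (cases "\<kappa> e = \<kappa> f")
      case True
      show ?thesis
      proof (rule ccontr)
        assume "\<not> ?thesis"
        then have "(fst e < i \<and> i < snd e) \<or> (fst f < i \<and> i < snd f)" using ef by auto
        moreover have "i \<noteq> snd e \<or> i \<noteq> snd f" "i \<noteq> fst e \<or> i \<noteq> fst f" using calculation by auto
        moreover have "fst e \<in> S (\<kappa> e)" "snd e \<in> S (\<kappa> e)" "fst f \<in> S (\<kappa> e)" "snd f \<in> S (\<kappa> e)"
          using R True unfolding R_def by auto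
        ultimately have "(i < snd e \<and> i < snd f) \<or> (fst e < i \<and> fst f < i)"
          using R ef True unfolding R_def by (smt (verit, best))
        \<comment> \<open>\<open>Runique\<close> compares arcs over the gap after a column:
          \<open>i\<close> serves if both continue to the right, \<open>i - 1\<close> if both come
          from the left.\<close>
        then have "e = f"
          using Runique[of "\<kappa> e" "fst e" "snd e" "fst f" "snd f" i]
            Runique[of "\<kappa> e" "fst e" "snd e" "fst f" "snd f" "i - 1"] R ef(4-7) True
          by (auto simp: prod_eq_iff)
        then show False using ef by simp
      qed
    next
      case False
      show ?thesis
      proof (cases "(fst (\<kappa> e), fst (snd (\<kappa> e))) = (fst (\<kappa> f), fst (snd (\<kappa> f)))")
        case True
        then have s: "snd (snd (\<kappa> e)) \<noteq> snd (snd (\<kappa> f))" using False by (auto simp: prod_eq_iff)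
        \<comment> \<open>Opposite halves of one circle meet only at its leftmost and rightmost
          points, and no arc has such a point in its interior.\<close>
        have 0: "sqrt ((fst (snd (\<kappa> e)))\<^sup>2 - (x i - fst (\<kappa> e) $ 1)\<^sup>2) = 0"
          using ef(8) s True unfolding y_def semicircle_def by (auto split: if_splits)
        then have sq: "(x i - fst (\<kappa> e) $ 1)\<^sup>2 = (fst (snd (\<kappa> e)))\<^sup>2" by simp
        have "\<bar>x i - fst (\<kappa> e) $ 1\<bar> = \<bar>fst (snd (\<kappa> e))\<bar>" using sq by (simp add: power2_eq_iff_nonneg abs_eq_iff power2_eq_iff)
        then have na: "\<not> \<bar>x i - fst (\<kappa> e) $ 1\<bar> < fst (snd (\<kappa> e))" by linarith
        have "\<not> (fst e < i \<and> i < snd e)"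
          using between'[OF R(1)] xmono iV eV[OF ef(1)] na by blast
        moreover have "\<not> (fst f < i \<and> i < snd f)"
          using between'[OF R(2), of "x i"] xmono iV eV[OF ef(2)] na True by auto
        ultimately show ?thesis using ef by auto
      next
        case ne: False
        define p where "p = (vector [x i, semicircle (\<kappa> e) (x i)] :: real^2)"
        have c: "fst (\<kappa> e) \<noteq> fst (\<kappa> f)" "dist (fst (\<kappa> e)) p = fst (snd (\<kappa> e))" "dist (fst (\<kappa> f)) p = fst (snd (\<kappa> f))"
          using common[OF ef(1,2) xi _ ne p_def] ef(8) unfolding y_def by auto
        have "\<exists>a' b'. a' \<in> P \<and> b' \<in> Q \<and> fst (snd (\<kappa> g)) = dist a' b' \<and> a' = fst (\<kappa> g)" if g: "g \<in> E" for g
        proof -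
          have "fst g \<in> S (\<kappa> g)" using \<kappa>[OF g] unfolding R_def by simp
          then have "fst (snd (\<kappa> g)) = dist (fst (\<kappa> g)) (b (fst g))"
            unfolding S_def semicircle_through_def by (auto simp: prod_eq_iff)
          then show ?thesis using centre[OF g] bQ eV[OF g] by blast
        qed
        then have "p \<in> circle_intersections P Q"
          unfolding circle_intersections_def using c ef(1,2) by (smt (verit) mem_Collect_eq)
        moreover have "p $ 1 = b i $ 1" unfolding p_def x_def by simp
        ultimately have "p = b i" using gen bQ[OF iV] unfolding inj_on_def by blast
        then have "y e i = Y i" "y f i = Y i" using ef(8) unfolding p_def Y_def y_def
          by (metis vector_2(2))+
        then show ?thesis
          using avoid[OF R(1) iV] avoid[OF R(2) iV] ef unfolding y_def by force
      qed
    qed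
  qed

  have cr: "card (crossings E y) \<le> 8 * (card P)\<^sup>2 * (card D)\<^sup>2"
  proof -
    define J where "J = (\<lambda>cc :: ((real^2) \<times> real \<times> bool) \<times> ((real^2) \<times> real \<times> bool). if fst (fst cc) = fst (snd cc) then {} else
      {p. dist (fst (fst cc)) p = fst (snd (fst cc)) \<and> dist (fst (snd cc)) p = fst (snd (snd cc))})"
    have J: "finite (J cc)" "card (J cc) \<le> 2" for cc
      using circle_inter[of "fst (fst cc)" "fst (snd cc)" "fst (snd (fst cc))" "fst (snd (snd cc))"]
      unfolding J_def by auto
    have ex: "\<exists>p. p \<in> J (\<kappa> e, \<kappa> f) \<and> x i < p $ 1 \<and> p $ 1 < x (i + 1)" if c: "(e, f, i) \<in> crossings E y" for e f i
    proof -
      have ef: "e \<in> E" "f \<in> E" "fst e \<le> i" "i < snd e" "fst f \<le> i" "i < snd f"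
        and lt: "semicircle (\<kappa> e) (x i) < semicircle (\<kappa> f) (x i)"
          "semicircle (\<kappa> f) (x (i + 1)) < semicircle (\<kappa> e) (x (i + 1))"
        using c unfolding crossings_def y_def by auto
      have iV: "i \<in> V" "i + 1 \<in> V" using inV[OF ef(1)] ef by auto
      have xi: "x (fst e) \<le> x i" "x (i + 1) \<le> x (snd e)" "x (fst f) \<le> x i" "x (i + 1) \<le> x (snd f)"
        "x i < x (i + 1)"
        using xmono' xmono eV[OF ef(1)] eV[OF ef(2)] iV ef by auto
      \<comment> \<open>Two halves of the same circle never exchange their order, so crossing edges
        come from different circles.\<close>
      have ne: "(fst (\<kappa> e), fst (snd (\<kappa> e))) \<noteq> (fst (\<kappa> f), fst (snd (\<kappa> f)))"
      proof
        assume eq: "(fst (\<kappa> e), fst (snd (\<kappa> e))) = (fst (\<kappa> f), fst (snd (\<kappa> f)))"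
        have pos: "sqrt ((fst (snd (\<kappa> e)))\<^sup>2 - (\<xi> - fst (\<kappa> e) $ 1)\<^sup>2) \<ge> 0" if "x i \<le> \<xi>" "\<xi> \<le> x (i + 1)" for \<xi>
        proof -
          have "\<bar>\<xi> - fst (\<kappa> e) $ 1\<bar> \<le> fst (snd (\<kappa> e))" using between[OF \<kappa>[OF ef(1)]] that xi by auto
          then have "(\<xi> - fst (\<kappa> e) $ 1)\<^sup>2 \<le> (fst (snd (\<kappa> e)))\<^sup>2" by (simp add: abs_le_square_iff[symmetric])
          then show ?thesis by simp
        qed
        show False using lt pos[of "x i"] pos[of "x (i + 1)"] xi(5) eq unfolding semicircle_def
          by (auto split: if_splits)
      qed
      have "\<exists>\<xi>\<ge>x i. \<xi> \<le> x (i + 1) \<and> semicircle (\<kappa> e) \<xi> - semicircle (\<kappa> f) \<xi> = 0"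
      proof (rule IVT')
        show "continuous_on {x i..x (i + 1)} (\<lambda>\<xi>. semicircle (\<kappa> e) \<xi> - semicircle (\<kappa> f) \<xi>)"
          by (intro continuous_on_diff continuous_semicircle)
      qed (use lt xi in auto)
      then obtain \<xi> where \<xi>: "x i \<le> \<xi>" "\<xi> \<le> x (i + 1)" "semicircle (\<kappa> e) \<xi> = semicircle (\<kappa> f) \<xi>" by auto
      have "\<xi> \<noteq> x i" "\<xi> \<noteq> x (i + 1)" using lt \<xi>(3) by auto
      then have "x i < \<xi>" "\<xi> < x (i + 1)" using \<xi> by auto
      moreover have "vector [\<xi>, semicircle (\<kappa> e) \<xi>] \<in> J (\<kappa> e, \<kappa> f)"
        using common[OF ef(1,2) _ _ _ _ \<xi>(3) ne refl] \<xi> xi unfolding J_def by auto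
      ultimately show ?thesis by (intro exI[of _ "vector [\<xi>, semicircle (\<kappa> e) \<xi>]"]) simp
    qed
    define \<pi> where "\<pi> = (\<lambda>(e, f, i). SOME p. p \<in> J (\<kappa> e, \<kappa> f) \<and> x i < p $ 1 \<and> p $ 1 < x (i + 1))"
    have \<pi>: "\<pi> (e, f, i) \<in> J (\<kappa> e, \<kappa> f) \<and> x i < \<pi> (e, f, i) $ 1 \<and> \<pi> (e, f, i) $ 1 < x (i + 1)"
      if "(e, f, i) \<in> crossings E y" for e f i
      unfolding \<pi>_def using someI_ex[OF ex[OF that]] by simp
    \<comment> \<open>The meeting point lies strictly between two neighbouring columns, so its
      abscissa recovers \<open>i\<close>. A semicircle and a gap then determine the arc, and hence
      the edge.\<close>
    define h where "h = (\<lambda>(e, f, i). ((\<kappa> e, \<kappa> f), \<pi> (e, f, i)))"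
    have "inj_on h (crossings E y)"
    proof (rule inj_onI)
      fix u v assume uv: "u \<in> crossings E y" "v \<in> crossings E y" "h u = h v"
      obtain e f i e' f' i' where u: "u = (e, f, i)" and v: "v = (e', f', i')" by (cases u, cases v)
      have k: "\<kappa> e = \<kappa> e'" "\<kappa> f = \<kappa> f'" "\<pi> (e, f, i) = \<pi> (e', f', i')"
        using uv(3) unfolding h_def u v by auto
      have m: "e \<in> E" "f \<in> E" "fst e \<le> i" "i < snd e" "fst f \<le> i" "i < snd f"
         "e' \<in> E" "f' \<in> E" "fst e' \<le> i'" "i' < snd e'" "fst f' \<le> i'" "i' < snd f'"
        using uv unfolding u v crossings_def by auto
      have V: "i \<in> V" "i + 1 \<in> V" "i' \<in> V" "i' + 1 \<in> V"
        using inV[OF m(1)] inV[OF m(7)] m by auto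
      have "x i < x (i' + 1)" "x i' < x (i + 1)"
        using \<pi>[of e f i] \<pi>[of e' f' i'] uv(1,2) k(3) unfolding u v by auto
      then have "\<not> i' + 1 \<le> i" "\<not> i + 1 \<le> i'" using xmono' V by force+
      then have i: "i = i'" by simp
      have "e = e'" using Runique[of "\<kappa> e" "fst e" "snd e" "fst e'" "snd e'" i] \<kappa>[OF m(1)] \<kappa>[OF m(7)] k(1) m i
        by (auto simp: prod_eq_iff)
      moreover have "f = f'" using Runique[of "\<kappa> f" "fst f" "snd f" "fst f'" "snd f'" i] \<kappa>[OF m(2)] \<kappa>[OF m(8)] k(2) m i
        by (auto simp: prod_eq_iff)
      ultimately show "u = v" using i unfolding u v by simp
    qed
    moreover have "h ` crossings E y \<subseteq> Sigma (CC \<times> CC) J"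
    proof (rule image_subsetI)
      fix u assume u: "u \<in> crossings E y"
      obtain e f i where ue: "u = (e, f, i)" by (cases u)
      then have "e \<in> E" "f \<in> E" using u unfolding crossings_def by auto
      then have "\<kappa> e \<in> CC" "\<kappa> f \<in> CC" using \<kappa> unfolding R_def by auto
      then show "h u \<in> Sigma (CC \<times> CC) J" using \<pi>[of e f i] u unfolding ue h_def by auto
    qed
    moreover have "finite (Sigma (CC \<times> CC) J)" using finCC J by blast
    ultimately have "card (crossings E y) \<le> card (Sigma (CC \<times> CC) J)" using card_inj_on_le by blast
    also have "\<dots> = (\<Sum>cc\<in>CC \<times> CC. card (J cc))" using finCC J by (subst card_SigmaI) auto
    also have "\<dots> \<le> (\<Sum>cc\<in>CC \<times> CC. 2)" by (rule sum_mono) (rule J)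
    \<comment> \<open>There are 2 |P| |D| semicircles, and each ordered pair of them contributes at
      most two points.\<close>
    also have "\<dots> = 8 * (card P)\<^sup>2 * (card D)\<^sup>2"
      by (simp add: card_cartesian_product cardCC power2_eq_square)
    finally show ?thesis .
  qed

  have AE: "card AA \<le> K * card E"
  proof -
    have "card AA = (\<Sum>e\<in>E. card {u \<in> AA. snd u = e})"
      by (rule card_eq_sum_fibres[OF finAA finE]) (simp add: E_def)
    also have "\<dots> \<le> (\<Sum>e\<in>E. K)"
    proof (rule sum_mono)
      fix e assume e: "e \<in> E"
      let ?T = "{a \<in> P. dist a (b (fst e)) = dist a (b (snd e))}"
      \<comment> \<open>A centre and one end determine the semicircle, so a pair of points carries
        at most one arc for each centre equidistant from both.\<close>
      have inj: "inj_on (\<lambda>u. fst (fst u)) {u \<in> AA. snd u = e}"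
      proof (rule inj_onI)
        fix u v assume uv: "u \<in> {u \<in> AA. snd u = e}" "v \<in> {u \<in> AA. snd u = e}" "fst (fst u) = fst (fst v)"
        then have "fst e \<in> S (fst u)" "fst e \<in> S (fst v)" unfolding AA_def R_def by auto
        then have "fst u = fst v" using uv(3) unfolding S_def by (metis (mono_tags, lifting) mem_Collect_eq)
        then show "u = v" using uv by (auto simp: prod_eq_iff)
      qed
      have sub: "(\<lambda>u. fst (fst u)) ` {u \<in> AA. snd u = e} \<subseteq> ?T"
      proof (rule image_subsetI)
        fix u assume "u \<in> {u \<in> AA. snd u = e}"
        then have R: "R (fst u) (fst e) (snd e)" unfolding AA_def by auto
        then have "semicircle_through (fst (fst u)) (b (fst e)) = semicircle_through (fst (fst u)) (b (snd e))"
          unfolding R_def S_def by auto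
        then have "dist (fst (fst u)) (b (fst e)) = dist (fst (fst u)) (b (snd e))"
          unfolding semicircle_through_def by simp
        moreover have "fst (fst u) \<in> P" using R unfolding R_def CC_def by (auto simp: mem_Times_iff)
        ultimately show "fst (fst u) \<in> ?T" by simp
      qed
      have "card {u \<in> AA. snd u = e} \<le> card ?T"
        using card_inj_on_le[OF inj sub] fin by simp
      also have "\<dots> \<le> K"
      proof (rule mult)
        show "b (fst e) \<noteq> b (snd e)" using xmono eV[OF e] unfolding x_def by force
      qed (use bQ eV[OF e] in auto)
      finally show "card {u \<in> AA. snd u = e} \<le> K" .
    qed
    finally show ?thesis by (simp add: mult.commute)
  qed

  have PQ: "card P * card Q \<le> card AA + 2 * card P * card D"
  proof -
    \<comment> \<open>An incidence either starts an arc or belongs to the last vertex on its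
      semicircle, and the latter happens at most once per semicircle.\<close>
    let ?I = "(\<lambda>(a, i). (semicircle_through a (b i), i)) ` (P \<times> V)"
    have "inj_on (\<lambda>(a, i). (semicircle_through a (b i), i)) (P \<times> V)"
      by (auto simp: inj_on_def semicircle_through_def)
    then have "card P * card Q = card ?I"
      by (simp add: card_image card_cartesian_product V_def)
    also have "\<dots> \<le> card ((\<lambda>u. (fst u, fst (snd u))) ` AA \<union> (\<lambda>c. (c, Max (S c))) ` CC)"
    proof (rule card_mono)
      show "finite ((\<lambda>u. (fst u, fst (snd u))) ` AA \<union> (\<lambda>c. (c, Max (S c))) ` CC)" using finAA finCC by simp
      show "?I \<subseteq> (\<lambda>u. (fst u, fst (snd u))) ` AA \<union> (\<lambda>c. (c, Max (S c))) ` CC"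
      proof (rule image_subsetI, clarify)
        fix a i assume a: "a \<in> P" "i \<in> V"
          "(semicircle_through a (b i), i) \<notin> (\<lambda>c. (c, Max (S c))) ` CC"
        define c where "c = semicircle_through a (b i)"
        have c: "c \<in> CC" unfolding c_def semicircle_through_def CC_def D_def using a bQ by auto
        have i: "i \<in> S c" using a unfolding S_def c_def semicircle_through_def by simp
        have "i \<noteq> Max (S c)" using a(3) c unfolding c_def by blast
        then have "i < Max (S c)" using Max_ge[OF finS i] by simp
        define T where "T = {j \<in> S c. i < j}"
        have "Max (S c) \<in> T" unfolding T_def using \<open>i < Max (S c)\<close> Max_in[OF finS[of c]] i by blast
        then have T: "finite T" "T \<noteq> {}" unfolding T_def using finS[of c] by auto
        define j where "j = Min T"
        have j: "j \<in> S c" "i < j" using Min_in[OF T] unfolding j_def[symmetric] unfolding T_def by auto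
        have "\<not> (i < k \<and> k < j)" if "k \<in> S c" for k
          using Min_le[OF T(1), of k] that unfolding j_def[symmetric] unfolding T_def by auto
        then have "R c i j" unfolding R_def using c i j by blast
        then have "(c, i, j) \<in> AA" unfolding AA_def by simp
        then show "(semicircle_through a (b i), i) \<in> (\<lambda>u. (fst u, fst (snd u))) ` AA"
          unfolding c_def[symmetric] by force
      qed
    qed
    also have "\<dots> \<le> card AA + card CC"
      using card_Un_le card_image_le[OF finAA] card_image_le[OF finCC] by (meson add_mono le_trans)
    finally show ?thesis using cardCC by simp
  qed

  have "t\<^sup>2 * card E \<le> 3 * t ^ 3 * card V + card (crossings E y)"
    by (rule crossing_lemma[OF dr t])
  also have "\<dots> \<le> 3 * t ^ 3 * card Q + 8 * (card P)\<^sup>2 * (card D)\<^sup>2"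
    using cr by (simp add: V_def)
  finally have "K * (t\<^sup>2 * card E) \<le> K * (3 * t ^ 3 * card Q + 8 * (card P)\<^sup>2 * (card D)\<^sup>2)" by simp
  moreover have "t\<^sup>2 * (card P * card Q) \<le> t\<^sup>2 * (K * card E + 2 * card P * card D)"
    using PQ AE by (intro mult_left_mono) linarith+
  ultimately show ?thesis unfolding D by (simp add: algebra_simps)
qed

section \<open>Removing the genericity assumption by a rotation\<close>

text \<open>This is the rotation that turns the direction (1, s) into the horizontal axis. The new
  abscissa is a positive multiple of the functional in \<open>ex_generic_direction\<close>.\<close>

definition rotate_to :: "real \<Rightarrow> real^2 \<Rightarrow> real^2"
  where "rotate_to s p = vector [(p $ 1 + s * p $ 2) / sqrt (1 + s\<^sup>2), (p $ 2 - s * p $ 1) / sqrt (1 + s\<^sup>2)]"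

lemma rotate_to_inverse: "rotate_to (- s) (rotate_to s p) = p"
proof -
  define r where "r = sqrt (1 + s\<^sup>2)"
  have pos: "1 + s\<^sup>2 > 0" by (simp add: add_pos_nonneg)
  have r: "r \<noteq> 0" "r * r = 1 + s\<^sup>2" using pos unfolding r_def by auto
  have "((p $ 1 + s * p $ 2) / r + - s * ((p $ 2 - s * p $ 1) / r)) / r = (1 + s\<^sup>2) * p $ 1 / (r * r)"
    "((p $ 2 - s * p $ 1) / r - - s * ((p $ 1 + s * p $ 2) / r)) / r = (1 + s\<^sup>2) * p $ 2 / (r * r)"
    using r(1) by (simp_all add: divide_simps) (simp_all add: power2_eq_square algebra_simps)
  then show ?thesis
    unfolding rotate_to_def vec2_eq_iff vector_2 power2_minus r_def[symmetric] r(2) using pos by simp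
qed

lemma dist_rotate_to: "dist (rotate_to s p) (rotate_to s q) = dist p q"
proof -
  define r where "r = sqrt (1 + s\<^sup>2)"
  have pos: "1 + s\<^sup>2 > 0" by (simp add: add_pos_nonneg)
  have r: "r\<^sup>2 = 1 + s\<^sup>2" using pos unfolding r_def by simp
  define u v where "u = p $ 1 - q $ 1" and "v = p $ 2 - q $ 2"
  have a: "(p $ 1 + s * p $ 2) / r - (q $ 1 + s * q $ 2) / r = (u + s * v) / r"
    "(p $ 2 - s * p $ 1) / r - (q $ 2 - s * q $ 1) / r = (v - s * u) / r"
    unfolding u_def v_def by (simp_all add: diff_divide_distrib add_divide_distrib algebra_simps)
  have "((u + s * v) / r)\<^sup>2 + ((v - s * u) / r)\<^sup>2 = ((1 + s\<^sup>2) * (u\<^sup>2 + v\<^sup>2)) / r\<^sup>2"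
    by (simp add: power_divide power2_eq_square algebra_simps flip: add_divide_distrib)
  also have "\<dots> = u\<^sup>2 + v\<^sup>2" unfolding r using pos by simp
  finally show ?thesis
    unfolding dist_vec2 rotate_to_def vector_2 r_def[symmetric] a u_def[symmetric] v_def[symmetric] by simp
qed

text \<open>Every quantity involved is invariant under isometries, so the configuration may first be
  turned until all relevant abscissae differ.\<close>

lemma incidence_bound:
  fixes P Q :: "(real^2) set"
  assumes fin: "finite P" "finite Q"
    and mult: "\<And>b b'. b \<in> Q \<Longrightarrow> b' \<in> Q \<Longrightarrow> b \<noteq> b' \<Longrightarrow> card {a \<in> P. dist a b = dist a b'} \<le> K"
    and t: "t \<ge> (1::nat)"
  shows "t\<^sup>2 * (card P * card Q) \<le> t\<^sup>2 * (2 * card P * num_distances P Q)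
    + K * (3 * t ^ 3 * card Q + 8 * (card P)\<^sup>2 * (num_distances P Q)\<^sup>2)"
proof -
  have "finite (Q \<union> circle_intersections P Q)" using fin finite_circle_intersections by simp
  then obtain s where s: "inj_on (\<lambda>p. p $ 1 + s * p $ 2) (Q \<union> circle_intersections P Q)"
    using ex_generic_direction by blast
  let ?\<rho> = "rotate_to s"
  have inj: "inj ?\<rho>" by (rule inj_on_inverseI) (rule rotate_to_inverse)
  have surj: "?\<rho> (rotate_to (- s) p) = p" for p using rotate_to_inverse[of "- s" p] by simp
  have card: "card (?\<rho> ` A) = card A" for A using inj by (intro card_image) (simp add: inj_on_def)
  have nd: "num_distances (?\<rho> ` P) (?\<rho> ` Q) = num_distances P Q"
    unfolding num_distances_def by (rule arg_cong[of _ _ card]) (auto simp: dist_rotate_to; metis dist_rotate_to imageI)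
  have ci: "circle_intersections (?\<rho> ` P) (?\<rho> ` Q) \<subseteq> ?\<rho> ` circle_intersections P Q"
  proof
    fix p assume "p \<in> circle_intersections (?\<rho> ` P) (?\<rho> ` Q)"
    then have "?\<rho> (rotate_to (- s) p) \<in> circle_intersections (?\<rho> ` P) (?\<rho> ` Q)" using surj by simp
    then have "rotate_to (- s) p \<in> circle_intersections P Q"
      unfolding circle_intersections_def by (simp add: dist_rotate_to) metis
    then show "p \<in> ?\<rho> ` circle_intersections P Q" using surj by (metis imageI)
  qed
  have fst_eq: "?\<rho> p $ 1 = ?\<rho> q $ 1 \<longleftrightarrow> p $ 1 + s * p $ 2 = q $ 1 + s * q $ 2" for p q
    using add_pos_nonneg[of 1 "s\<^sup>2"] unfolding rotate_to_def by simp
  have "inj_on (\<lambda>p. p $ 1) (?\<rho> ` (Q \<union> circle_intersections P Q))"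
  proof (rule inj_onI)
    fix u v assume uv: "u \<in> ?\<rho> ` (Q \<union> circle_intersections P Q)" "v \<in> ?\<rho> ` (Q \<union> circle_intersections P Q)" "u $ 1 = v $ 1"
    then obtain p q where "u = ?\<rho> p" "v = ?\<rho> q" "p \<in> Q \<union> circle_intersections P Q" "q \<in> Q \<union> circle_intersections P Q" by blast
    then show "u = v" using uv(3) fst_eq inj_onD[OF s] by metis
  qed
  then have gen: "inj_on (\<lambda>p. p $ 1) (?\<rho> ` Q \<union> circle_intersections (?\<rho> ` P) (?\<rho> ` Q))"
    by (rule inj_on_subset) (use ci in blast)
  have mult': "card {a \<in> ?\<rho> ` P. dist a b = dist a b'} \<le> K" if b: "b \<in> ?\<rho> ` Q" "b' \<in> ?\<rho> ` Q" "b \<noteq> b'" for b b'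
  proof -
    obtain c c' where c: "b = ?\<rho> c" "b' = ?\<rho> c'" "c \<in> Q" "c' \<in> Q" using b by blast
    have "{a \<in> ?\<rho> ` P. dist a b = dist a b'} = ?\<rho> ` {a \<in> P. dist a c = dist a c'}"
      unfolding c by (auto simp: dist_rotate_to)
    then show ?thesis using mult[of c c'] c b(3) by (auto simp: card)
  qed
  show ?thesis
    using incidence_bound_generic[OF _ _ mult' gen t] fin by (simp add: card nd)
qed

section \<open>Lines and circles in an algebraic curve\<close>

lemma bivariate_eval_sum:
  "bivariate_eval f p = (\<Sum>j\<le>degree f. \<Sum>i\<le>degree (coeff f j). coeff (coeff f j) i * (p $ 1) ^ i * (p $ 2) ^ j)"
proof -
  have "bivariate_eval f p = (\<Sum>j\<le>degree f. poly (coeff f j) (p $ 1) * (p $ 2) ^ j)"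
    unfolding bivariate_eval_def by (simp add: poly_altdef[of f] poly_sum poly_mult poly_power)
  also have "\<dots> = (\<Sum>j\<le>degree f. \<Sum>i\<le>degree (coeff f j). coeff (coeff f j) i * (p $ 1) ^ i * (p $ 2) ^ j)"
    by (simp add: poly_altdef sum_distrib_right)
  finally show ?thesis .
qed

lemma le_total_degree:
  assumes "coeff (coeff f j) i \<noteq> 0"
  shows "i + j \<le> total_degree f"
proof -
  let ?S = "{i + j | i j. coeff (coeff f j) i \<noteq> 0}"
  have "?S \<subseteq> (\<lambda>(i, j). i + j) ` (SIGMA j:{..degree f}. {..degree (coeff f j)})\<inverse>"
  proof
    fix k assume "k \<in> ?S"
    then obtain i j where ij: "k = i + j" "coeff (coeff f j) i \<noteq> 0" by blast
    then have "i \<le> degree (coeff f j)" "j \<le> degree f" by (auto intro!: le_degree)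
    then show "k \<in> (\<lambda>(i, j). i + j) ` (SIGMA j:{..degree f}. {..degree (coeff f j)})\<inverse>" using ij(1) by force
  qed
  then have "finite ?S" by (rule finite_subset) simp
  then show ?thesis unfolding total_degree_def using assms by (intro Max_ge) auto
qed

text \<open>Substituting a rational parametrisation and clearing denominators leaves a univariate
  polynomial. The exponent \<open>?r - i - j\<close> is a true difference whenever the coefficient
  is nonzero. Lines are the case \<open>d = 1\<close> with \<open>W = 1\<close>, circles the case
  \<open>d = 2\<close> with \<open>W = 1 + t^2\<close>.\<close>

lemma homogenisation:
  fixes X Y W :: "real poly"
  assumes deg: "degree X \<le> d" "degree Y \<le> d" "degree W \<le> d"
  shows "\<exists>g. degree g \<le> d * total_degree f \<and> (\<forall>t. poly W t \<noteq> 0 \<longrightarrow>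
    poly g t = poly W t ^ total_degree f * bivariate_eval f (vector [poly X t / poly W t, poly Y t / poly W t]))"
proof -
  let ?r = "total_degree f"
  define g where "g = (\<Sum>j\<le>degree f. \<Sum>i\<le>degree (coeff f j).
    smult (coeff (coeff f j) i) (X ^ i * Y ^ j * W ^ (?r - i - j)))"
  have "degree (smult (coeff (coeff f j) i) (X ^ i * Y ^ j * W ^ (?r - i - j))) \<le> d * ?r" for i j
  proof (cases "coeff (coeff f j) i = 0")
    case False
    have "degree (X ^ i * Y ^ j * W ^ (?r - i - j)) \<le> d * i + d * j + d * (?r - i - j)"
    proof -
      have "degree (Z ^ k) \<le> d * k" if "degree Z \<le> d" for k and Z :: "real poly"
        using degree_power_le[of Z k] that by (meson le_trans mult_le_mono1)
      then show ?thesis using deg by (meson add_mono degree_mult_le le_trans)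
    qed
    also have "\<dots> = d * (i + j + (?r - i - j))" by (simp add: algebra_simps)
    also have "i + j + (?r - i - j) = ?r" using le_total_degree[OF False] by simp
    finally show ?thesis using degree_smult_le le_trans by blast
  qed simp
  then have "degree g \<le> d * ?r" unfolding g_def by (intro degree_sum_le) auto
  moreover have "poly g t = poly W t ^ ?r * bivariate_eval f (vector [poly X t / poly W t, poly Y t / poly W t])"
    if W: "poly W t \<noteq> 0" for t
  proof -
    have "poly (smult (coeff (coeff f j) i) (X ^ i * Y ^ j * W ^ (?r - i - j))) t
      = poly W t ^ ?r * (coeff (coeff f j) i * (poly X t / poly W t) ^ i * (poly Y t / poly W t) ^ j)" for i j
    proof (cases "coeff (coeff f j) i = 0")
      case False
      have "poly W t ^ ?r = poly W t ^ i * poly W t ^ j * poly W t ^ (?r - i - j)"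
        using le_total_degree[OF False] by (simp flip: power_add)
      then show ?thesis using W by (simp add: poly_power power_divide field_simps)
    qed simp
    then show ?thesis
      unfolding g_def bivariate_eval_sum vector_2 poly_sum sum_distrib_left by (intro sum.cong refl)
  qed
  ultimately show ?thesis by blast
qed

lemma poly_zero_of_roots:
  fixes g :: "real poly"
  assumes "finite T" "card T > degree g" "\<And>t. t \<in> T \<Longrightarrow> poly g t = 0"
  shows "g = 0"
proof (rule ccontr)
  assume g: "g \<noteq> 0"
  have "card T \<le> card {t. poly g t = 0}"
    by (rule card_mono) (use poly_roots_finite[OF g] assms(3) in auto)
  also have "\<dots> \<le> degree g" by (rule card_poly_roots_bound[OF g])
  finally show False using assms(2) by simp
qed

text \<open>This univariate root count takes the place of Bezout's theorem.\<close>

lemma parametrised_in_curve: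
  fixes X Y W :: "real poly"
  assumes \<gamma>: "plane_curve r \<gamma>" and deg: "degree X \<le> d" "degree Y \<le> d" "degree W \<le> d"
    and W: "\<And>t. poly W t \<noteq> 0" and T: "finite T" "card T > d * r"
    and in_\<gamma>: "\<And>t. t \<in> T \<Longrightarrow> vector [poly X t / poly W t, poly Y t / poly W t] \<in> \<gamma>"
  shows "vector [poly X t / poly W t, poly Y t / poly W t] \<in> \<gamma>"
proof -
  obtain f where f: "total_degree f = r" "\<gamma> = {p. bivariate_eval f p = 0}"
    using \<gamma> unfolding plane_curve_def by blast
  obtain g where g: "degree g \<le> d * r" "\<And>t. poly g t = poly W t ^ r * bivariate_eval f (vector [poly X t / poly W t, poly Y t / poly W t])"
    using homogenisation[OF deg, of f] W unfolding f(1) by blast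
  have "g = 0"
    by (rule poly_zero_of_roots[OF T(1)]) (use g T(2) in_\<gamma> f(2) in auto)
  then show ?thesis using g(2)[of t] W[of t] unfolding f(2) by simp
qed

lemma line_in_curve:
  assumes "plane_curve r \<gamma>" "finite T" "card T > r"
    and "\<And>t. t \<in> T \<Longrightarrow> vector [x + t * u, y + t * v] \<in> \<gamma>"
  shows "vector [x + t * u, y + t * v] \<in> \<gamma>"
  using parametrised_in_curve[of r \<gamma> "[:x, u:]" 1 "[:y, v:]" 1 T t] assms by simp

text \<open>If \<open>f\<close> vanished everywhere, every constant polynomial in \<open>x\<close>
  would be a root of \<open>f\<close> as a polynomial in \<open>y\<close> over an integral domain. A
  point off the curve later serves as base point for counting the lines and circles contained in
  it.\<close>

lemma plane_curve_complement:
  assumes "plane_curve r \<gamma>"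
  shows "\<exists>q. q \<notin> \<gamma>"
proof (rule ccontr)
  obtain f where f: "f \<noteq> 0" "\<gamma> = {p. bivariate_eval f p = 0}"
    using assms unfolding plane_curve_def by blast
  assume "\<nexists>q. q \<notin> \<gamma>"
  then have 0: "bivariate_eval f (vector [x, c]) = 0" for x c using f(2) by blast
  have "poly (poly f [:c:]) x = 0" for x c using 0[of x c] unfolding bivariate_eval_def by simp
  then have "poly f [:c:] = 0" for c using poly_all_0_iff_0 by blast
  then have "range (\<lambda>c::real. [:c:]) \<subseteq> {z. poly f z = 0}" by auto
  then have "finite (range (\<lambda>c::real. [:c:]))" using poly_roots_finite[OF f(1)] finite_subset by blast
  moreover have "inj (\<lambda>c::real. [:c:])" by (simp add: inj_on_def)
  ultimately show False using finite_imageD infinite_UNIV_char_0 by blast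
qed

text \<open>This is stereographic projection from the point
  \<open>vector [b $ 1 - \<epsilon> * d, b $ 2]\<close>; the parameter \<open>t\<close> is the slope
  of the line from there to \<open>p\<close>.\<close>

lemma circle_parametrisation:
  fixes b p :: "real^2" and \<epsilon> :: real
  assumes p: "dist b p = d" "\<epsilon> = 1 \<or> \<epsilon> = - 1" "\<epsilon> * d + (p $ 1 - b $ 1) \<noteq> 0"
  shows "\<exists>t. p = vector [poly [:b $ 1 + \<epsilon> * d, 0, b $ 1 - \<epsilon> * d:] t / poly [:1, 0, 1:] t,
    poly [:b $ 2, 2 * \<epsilon> * d, b $ 2:] t / poly [:1, 0, 1:] t]"
proof -
  define u v e where "u = p $ 1 - b $ 1" and "v = p $ 2 - b $ 2" and "e = \<epsilon> * d"
  have uv: "u\<^sup>2 + v\<^sup>2 = e\<^sup>2" "e + u \<noteq> 0"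
    using p unfolding u_def v_def e_def dist_vec2_eq by (auto simp: power2_eq_square algebra_simps)
  define t where "t = v / (e + u)"
  have t: "t * (e + u) = v" using uv unfolding t_def by simp
  have ne: "1 + t * t \<noteq> 0" by (metis add_nonneg_eq_0_iff zero_le_one zero_le_square zero_neq_one)
  have v2: "v * v = (e - u) * (e + u)" using uv by (simp add: power2_eq_square algebra_simps)
  have "t * v * (e + u) = (e - u) * (e + u)" using v2 t by (metis mult.assoc mult.commute)
  then have tv: "t * v = e - u" using uv by simp
  have "(1 + t * t) * u = e - e * (t * t)"
  proof -
    have "t * t * (e + u) = e - u" using tv t by (metis mult.assoc)
    then show ?thesis by (simp add: algebra_simps)
  qed
  moreover have "(1 + t * t) * v = 2 * e * t"
  proof -
    have "t * t * v = t * (e - u)" using tv by (metis mult.assoc)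
    then show ?thesis using t by (simp add: algebra_simps)
  qed
  ultimately have "p $ 1 = (b $ 1 + e + t * (t * (b $ 1 - e))) / (1 + t * t)" "p $ 2 = (b $ 2 + t * (2 * e + t * b $ 2)) / (1 + t * t)"
    using ne unfolding u_def v_def by (simp_all add: field_simps)
  then show ?thesis unfolding vec2_eq_iff vector_2 e_def by (intro exI[of _ t]) (simp add: mult.assoc)
qed

text \<open>The rational parametrisation misses one point of the circle; the two signs \<open>\<epsilon>\<close> miss opposite points.\<close>

lemma circle_in_curve:
  assumes \<gamma>: "plane_curve r \<gamma>" and S: "finite S" "S \<subseteq> \<gamma>" "\<And>p. p \<in> S \<Longrightarrow> dist b p = d" "card S > 2 * r + 1"
    and d: "d > 0" and p: "dist b p = d"
  shows "p \<in> \<gamma>"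
proof -
  let ?\<phi> = "\<lambda>\<epsilon> t. vector [poly [:b $ 1 + \<epsilon> * d, 0, b $ 1 - \<epsilon> * d:] t / poly [:1, 0, 1:] t,
    poly [:b $ 2, 2 * \<epsilon> * d, b $ 2:] t / poly [:1, 0, 1:] t] :: real^2"
  have W: "poly [:1, 0, 1:] t \<noteq> 0" for t :: real
    by simp (metis add_nonneg_eq_0_iff zero_le_one zero_le_square zero_neq_one)
  have "p \<in> \<gamma>" if \<epsilon>: "\<epsilon> = 1 \<or> \<epsilon> = - 1" and p': "\<epsilon> * d + (p $ 1 - b $ 1) \<noteq> 0" for \<epsilon> :: real
  proof -
    define pole where "pole = (vector [b $ 1 - \<epsilon> * d, b $ 2] :: real^2)"
    have "\<exists>t. z = ?\<phi> \<epsilon> t" if z: "z \<in> S - {pole}" for z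
    proof -
      have "\<epsilon> * d + (z $ 1 - b $ 1) \<noteq> 0"
      proof
        assume 0: "\<epsilon> * d + (z $ 1 - b $ 1) = 0"
        then have 1: "z $ 1 = b $ 1 - \<epsilon> * d" by simp
        have "(b $ 1 - z $ 1)\<^sup>2 = d\<^sup>2" using 1 \<epsilon> by auto
        then have "z $ 2 = b $ 2" using S(3)[of z] z unfolding dist_vec2_eq by simp
        then have "z = pole" using 1 unfolding pole_def vec2_eq_iff by simp
        then show False using z by simp
      qed
      then show ?thesis using circle_parametrisation S(3) z \<epsilon> by blast
    qed
    then obtain \<tau> where \<tau>: "\<And>z. z \<in> S - {pole} \<Longrightarrow> z = ?\<phi> \<epsilon> (\<tau> z)" by metis
    have "inj_on \<tau> (S - {pole})" by (rule inj_onI) (metis \<tau>)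
    then have "card (\<tau> ` (S - {pole})) = card (S - {pole})" by (rule card_image)
    \<comment> \<open>The \<open>+ 1\<close> in the hypothesis on \<open>card S\<close> pays for the
      pole, which the parametrisation misses.\<close>
    moreover have "card (S - {pole}) > 2 * r" using S(1,4) by (cases "pole \<in> S") auto
    ultimately have c: "card (\<tau> ` (S - {pole})) > 2 * r" by simp
    have "?\<phi> \<epsilon> t \<in> \<gamma>" for t
    proof (rule parametrised_in_curve[OF \<gamma> _ _ _ W _ c])
      fix t assume "t \<in> \<tau> ` (S - {pole})"
      then obtain z where z: "z \<in> S - {pole}" "t = \<tau> z" by blast
      then show "?\<phi> \<epsilon> t \<in> \<gamma>" using \<tau>[OF z(1)] S(2) by auto
    qed (use S(1) in auto)
    then show ?thesis using circle_parametrisation[OF p \<epsilon> p'] by metis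
  qed
  moreover have "1 * d + (p $ 1 - b $ 1) \<noteq> 0 \<or> - 1 * d + (p $ 1 - b $ 1) \<noteq> 0" using d by auto
  ultimately show ?thesis by blast
qed

lemma ex_large_finite_subset:
  assumes "\<not> (finite A \<and> card A \<le> r)"
  shows "\<exists>T. T \<subseteq> A \<and> finite T \<and> card T > r"
proof (cases "finite A")
  case True
  then show ?thesis using assms by (intro exI[of _ A]) auto
next
  case False
  then obtain T where "finite T" "card T = Suc r" "T \<subseteq> A" using infinite_arbitrarily_large by blast
  then show ?thesis by (intro exI[of _ T]) simp
qed

text \<open>The ray from \<open>b\<close> towards a point \<open>q\<close> off the curve meets
  circles of different radii at different parameters. More than \<open>r\<close> contained circles
  would put the whole line, and with it \<open>q\<close>, into the curve. If \<open>q\<close> equals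
  \<open>b\<close>, any direction serves.\<close>

lemma circles_in_curve_about:
  assumes \<gamma>: "plane_curve r \<gamma>"
  shows "finite {d. d > 0 \<and> (\<forall>p. dist b p = d \<longrightarrow> p \<in> \<gamma>)} \<and> card {d. d > 0 \<and> (\<forall>p. dist b p = d \<longrightarrow> p \<in> \<gamma>)} \<le> r"
proof (rule ccontr)
  let ?D = "{d. d > 0 \<and> (\<forall>p. dist b p = d \<longrightarrow> p \<in> \<gamma>)}"
  assume "\<not> ?thesis"
  then obtain T where T: "T \<subseteq> ?D" "finite T" "card T > r"
    using ex_large_finite_subset by blast
  obtain q where q: "q \<notin> \<gamma>" using plane_curve_complement[OF \<gamma>] by blast
  define u where "u = (if q = b then vector [1, 0] else (1 / norm (q - b)) *\<^sub>R (q - b))"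
  have "norm (vector [1, 0] :: real^2) = 1" by (simp add: norm_vec_def L2_set_def sum_2)
  then have u1: "norm u = 1" unfolding u_def by simp
  have qu: "q = b + norm (q - b) *\<^sub>R u" unfolding u_def by auto
  have eq: "vector [b $ 1 + t * u $ 1, b $ 2 + t * u $ 2] = b + t *\<^sub>R u" for t
    unfolding vec2_eq_iff vector_2 by simp
  have "vector [b $ 1 + norm (q - b) * u $ 1, b $ 2 + norm (q - b) * u $ 2] \<in> \<gamma>"
  proof (rule line_in_curve[OF \<gamma> T(2,3)])
    fix t assume "t \<in> T"
    then have t: "t > 0" "\<And>p. dist b p = t \<Longrightarrow> p \<in> \<gamma>" using T(1) by auto
    have "dist b (b + t *\<^sub>R u) = t" using t(1) u1 by (simp add: dist_norm)
    then show "vector [b $ 1 + t * u $ 1, b $ 2 + t * u $ 2] \<in> \<gamma>" using t(2) eq by simp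
  qed
  then show False using q qu eq by simp
qed

section \<open>Elementary lower bounds for the number of distances\<close>

text \<open>The distances to two fixed points of \<open>P\<close> determine a point of
  \<open>Q\<close> up to two choices.\<close>

lemma card_le_num_distances_squared:
  assumes fin: "finite P" "finite Q" and a: "a \<in> P" "a' \<in> P" "a \<noteq> a'"
  shows "card Q \<le> 2 * (num_distances P Q)\<^sup>2"
proof -
  define D where "D = {dist a b | a b. a \<in> P \<and> b \<in> Q}"
  have finD: "finite D" unfolding D_def using finite_distances[OF fin] .
  have "card Q = (\<Sum>j\<in>D \<times> D. card {b \<in> Q. (dist a b, dist a' b) = j})"
    by (rule card_eq_sum_fibres) (use fin finD a in \<open>auto simp: D_def\<close>)
  also have "\<dots> \<le> (\<Sum>j\<in>D \<times> D. 2)"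
  proof (rule sum_mono)
    fix j
    have "{b \<in> Q. (dist a b, dist a' b) = j} \<subseteq> {b. dist a b = fst j \<and> dist a' b = snd j}" by auto
    then show "card {b \<in> Q. (dist a b, dist a' b) = j} \<le> 2"
      using circle_inter[OF a(3), of "fst j" "snd j"] by (meson card_mono le_trans)
  qed
  also have "\<dots> = 2 * (num_distances P Q)\<^sup>2"
    unfolding num_distances_def D_def by (simp add: card_cartesian_product power2_eq_square)
  finally show ?thesis .
qed

lemma num_distances_pos:
  assumes "finite P" "finite Q" "P \<noteq> {}" "Q \<noteq> {}"
  shows "num_distances P Q \<ge> 1"
proof -
  have "{dist a b | a b. a \<in> P \<and> b \<in> Q} \<noteq> {}" using assms by auto
  then show ?thesis unfolding num_distances_def
    using finite_distances[OF assms(1,2)] by (simp add: Suc_leI card_gt_0_iff)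
qed

lemma num_distances_mono:
  assumes "finite P" "finite Q" "P' \<subseteq> P" "Q' \<subseteq> Q"
  shows "num_distances P' Q' \<le> num_distances P Q"
  unfolding num_distances_def
  by (rule card_mono[OF finite_distances[OF assms(1,2)]]) (use assms in blast)

text \<open>A point of \<open>P\<close> off the contained circles about \<open>b\<close> shares its
  distance from \<open>b\<close> with at most \<open>2 * r\<close> others. Contained circles may
  hold many points, and for this a second centre is used: the points on contained circles about both
  centres lie on at most \<open>r * r\<close> pairs of circles, two on each pair.\<close>

lemma card_on_curve_le_num_distances:
  assumes \<gamma>: "plane_curve r \<gamma>" "P \<subseteq> \<gamma>" and fin: "finite P" "finite Q"
    and b: "b \<in> Q" "b' \<in> Q" "b \<noteq> b'" and "P \<noteq> {}"
  shows "card P \<le> 2 * (r + 1)\<^sup>2 * num_distances P Q"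
proof -
  define D where "D = {dist a b | a b. a \<in> P \<and> b \<in> Q}"
  have finD: "finite D" unfolding D_def using finite_distances[OF fin] .
  define C where "C = (\<lambda>b. {d. d > 0 \<and> (\<forall>p. dist b p = d \<longrightarrow> p \<in> \<gamma>)})"
  define S where "S = (\<lambda>b. {a \<in> P. dist b a \<in> C b})"
  have C: "finite (C b)" "card (C b) \<le> r" for b
    using circles_in_curve_about[OF \<gamma>(1)] unfolding C_def by auto
  have out: "card (P - S b) \<le> (2 * r + 1) * card D" if "b \<in> Q" for b
  proof -
    have "card (P - S b) = (\<Sum>d\<in>D. card {a \<in> P - S b. dist a b = d})"
      by (rule card_eq_sum_fibres) (use fin finD that in \<open>auto simp: D_def\<close>)
    also have "\<dots> \<le> (\<Sum>d\<in>D. 2 * r + 1)"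
    proof (rule sum_mono, rule ccontr)
      fix d assume "\<not> card {a \<in> P - S b. dist a b = d} \<le> 2 * r + 1"
      then have big: "card {a \<in> P - S b. dist a b = d} > 2 * r + 1" by simp
      let ?T = "{a \<in> P - S b. dist a b = d}"
      have "?T \<noteq> {}" using big by (metis card.empty not_less_zero)
      then obtain a where a: "a \<in> ?T" by blast
      have "d > 0"
      proof (rule ccontr)
        assume "\<not> d > 0"
        then have "?T \<subseteq> {b}" by (auto simp: not_less)
        then have "card ?T \<le> card {b}" by (intro card_mono) auto
        then show False using big by simp
      qed
      moreover have "p \<in> \<gamma>" if "dist b p = d" for p
        by (rule circle_in_curve[OF \<gamma>(1) _ _ _ big \<open>d > 0\<close> that]) (use fin \<gamma> in \<open>auto simp: dist_commute\<close>)
      ultimately have "d \<in> C b" unfolding C_def by simp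
      then have "a \<in> S b" using a unfolding S_def by (auto simp: dist_commute)
      then show False using a by simp
    qed
    finally show ?thesis by (simp add: mult.commute)
  qed
  have inter: "card (S b \<inter> S b') \<le> 2 * r\<^sup>2"
  proof -
    have "card (S b \<inter> S b') = (\<Sum>j\<in>C b \<times> C b'. card {a \<in> S b \<inter> S b'. (dist b a, dist b' a) = j})"
      by (rule card_eq_sum_fibres) (use fin C in \<open>auto simp: S_def\<close>)
    also have "\<dots> \<le> (\<Sum>j\<in>C b \<times> C b'. 2)"
    proof (rule sum_mono)
      fix j
      have "{a \<in> S b \<inter> S b'. (dist b a, dist b' a) = j} \<subseteq> {a. dist b a = fst j \<and> dist b' a = snd j}" by auto
      then show "card {a \<in> S b \<inter> S b'. (dist b a, dist b' a) = j} \<le> 2"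
        using circle_inter[OF b(3), of "fst j" "snd j"] by (meson card_mono le_trans)
    qed
    also have "\<dots> = card (C b) * card (C b') * 2" by (simp add: card_cartesian_product)
    also have "\<dots> \<le> r * r * 2" using C by (intro mult_mono) auto
    finally show ?thesis by (simp add: power2_eq_square)
  qed
  have "P = (P - S b) \<union> (P - S b') \<union> (S b \<inter> S b')" unfolding S_def by auto
  then have "card P \<le> card (P - S b) + card (P - S b') + card (S b \<inter> S b')"
    by (metis (no_types, lifting) card_Un_le add_right_mono le_trans)
  also have "\<dots> \<le> 2 * ((2 * r + 1) * card D) + 2 * r\<^sup>2"
    using out[OF b(1)] out[OF b(2)] inter by linarith
  \<comment> \<open>At least one distance occurs, so the constant term can be multiplied by
    \<open>card D\<close>; then 2 (2 r + 1) + 2 r^2 = 2 (r + 1)^2.\<close>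
  also have "\<dots> \<le> 2 * ((2 * r + 1) * card D) + 2 * r\<^sup>2 * card D"
    using num_distances_pos[OF fin \<open>P \<noteq> {}\<close>] b unfolding num_distances_def D_def[symmetric] by fastforce
  also have "\<dots> = 2 * (r + 1)\<^sup>2 * num_distances P Q"
    unfolding num_distances_def D_def[symmetric] by (simp add: power2_eq_square algebra_simps)
  finally show ?thesis .
qed

section \<open>Lines contained in the curve\<close>

text \<open>These are dual coordinates: every line missing \<open>q\<close> arises from exactly one
  nonzero \<open>w\<close>, so such lines can be counted as vectors. With \<open>q\<close> off the
  curve, all lines contained in the curve are covered.\<close>

definition line_avoiding :: "real^2 \<Rightarrow> real^2 \<Rightarrow> (real^2) set"
  where "line_avoiding q w = {p. w $ 1 * (p $ 1 - q $ 1) + w $ 2 * (p $ 2 - q $ 2) = 1}"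

text \<open>A generic line through a point \<open>q\<close> off the curve meets the lines contained in the curve in distinct
  points, and \<open>inj_on\<close> on \<open>insert 0 T\<close> expresses that genericity.\<close>

lemma lines_in_curve:
  assumes \<gamma>: "plane_curve r \<gamma>" and q: "q \<notin> \<gamma>"
  shows "finite {w. w \<noteq> 0 \<and> line_avoiding q w \<subseteq> \<gamma>} \<and> card {w. w \<noteq> 0 \<and> line_avoiding q w \<subseteq> \<gamma>} \<le> r"
proof (rule ccontr)
  let ?A = "{w. w \<noteq> 0 \<and> line_avoiding q w \<subseteq> \<gamma>}"
  assume "\<not> ?thesis"
  then obtain T where T: "T \<subseteq> ?A" "finite T" "card T > r"
    using ex_large_finite_subset by blast
  obtain s where s: "inj_on (\<lambda>p. p $ 1 + s * p $ 2) (insert 0 T)"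
    using ex_generic_direction[of "insert 0 T"] T(2) by blast
  \<comment> \<open>This is the parameter at which the line of direction (1, s) through
    \<open>q\<close> meets the line with dual vector \<open>w\<close>.\<close>
  define \<tau> where "\<tau> = (\<lambda>w::real^2. 1 / (w $ 1 + s * w $ 2))"
  have nz: "w $ 1 + s * w $ 2 \<noteq> 0" if "w \<in> T" for w
    using inj_onD[OF s, of w 0] that T(1) by auto
  have "inj_on \<tau> T"
  proof (rule inj_onI)
    fix u v assume uv: "u \<in> T" "v \<in> T" "\<tau> u = \<tau> v"
    then have "u $ 1 + s * u $ 2 = v $ 1 + s * v $ 2" using nz unfolding \<tau>_def by simp
    then show "u = v" using inj_onD[OF s] uv by blast
  qed
  then have c: "card (\<tau> ` T) > r" using T(3) by (simp add: card_image)
  have "vector [q $ 1 + 0 * 1, q $ 2 + 0 * s] \<in> \<gamma>"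
  proof (rule line_in_curve[OF \<gamma> _ c])
    fix t assume "t \<in> \<tau> ` T"
    then obtain w where w: "w \<in> T" "t = \<tau> w" by blast
    then have "t * (w $ 1 + s * w $ 2) = 1" using nz unfolding \<tau>_def by simp
    then have "vector [q $ 1 + t * 1, q $ 2 + t * s] \<in> line_avoiding q w"
      unfolding line_avoiding_def by (simp add: algebra_simps)
    then show "vector [q $ 1 + t * 1, q $ 2 + t * s] \<in> \<gamma>" using w(1) T(1) by blast
  qed (use T(2) in simp)
  moreover have "vector [q $ 1 + 0 * 1, q $ 2 + 0 * s] = q" unfolding vec2_eq_iff by simp
  ultimately show False using q by simp
qed

lemma bisector_in_curve:
  fixes b b' :: "real^2"
  assumes \<gamma>: "plane_curve r \<gamma>" and T: "finite T" "card T > r" "T \<subseteq> \<gamma>" "\<And>a. a \<in> T \<Longrightarrow> dist a b = dist a b'"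
    and ne: "b \<noteq> b'"
  shows "{p. dist p b = dist p b'} \<subseteq> \<gamma>"
proof -
  define v w where "v = b' $ 1 - b $ 1" and "w = b' $ 2 - b $ 2"
  define x y where "x = (b $ 1 + b' $ 1) / 2" and "y = (b $ 2 + b' $ 2) / 2"
  have vw: "v \<noteq> 0 \<or> w \<noteq> 0" using ne unfolding v_def w_def vec2_eq_iff by auto
  have par: "\<exists>t. p = vector [x + t * - w, y + t * v]" if "dist p b = dist p b'" for p
  proof -
    have "(p $ 1 - b $ 1)\<^sup>2 + (p $ 2 - b $ 2)\<^sup>2 = (p $ 1 - b' $ 1)\<^sup>2 + (p $ 2 - b' $ 2)\<^sup>2"
      using that unfolding dist_vec2 by simp
    then have "v * (p $ 1 - x) + w * (p $ 2 - y) = 0"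
      unfolding v_def w_def x_def y_def by (simp add: power2_eq_square field_simps)
    from orthogonal_vec2[OF this vw] obtain t where "p $ 1 - x = - t * w" "p $ 2 - y = t * v" by blast
    then show ?thesis unfolding vec2_eq_iff vector_2 by (intro exI[of _ t]) (simp add: algebra_simps)
  qed
  then obtain \<tau> where \<tau>: "\<And>p. dist p b = dist p b' \<Longrightarrow> p = vector [x + \<tau> p * - w, y + \<tau> p * v]" by metis
  have "inj_on \<tau> T" by (rule inj_onI) (metis \<tau> T(4))
  then have c: "card (\<tau> ` T) > r" using T(2) by (simp add: card_image)
  have "vector [x + t * - w, y + t * v] \<in> \<gamma>" for t
  proof (rule line_in_curve[OF \<gamma> _ c])
    fix t assume "t \<in> \<tau> ` T"
    then obtain a where "a \<in> T" "t = \<tau> a" by blast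
    then show "vector [x + t * - w, y + t * v] \<in> \<gamma>" using \<tau>[of a] T(3,4) by auto
  qed (use T(1) in simp)
  note line = this
  show ?thesis
  proof
    fix p assume "p \<in> {p. dist p b = dist p b'}"
    then have "p = vector [x + \<tau> p * - w, y + \<tau> p * v]" using \<tau> by blast
    then show "p \<in> \<gamma>" by (rule ssubst[where P = "\<lambda>z. z \<in> \<gamma>"]) (rule line)
  qed
qed

lemma bisector_eq_line_avoiding:
  fixes b b' q :: "real^2"
  assumes "dist q b \<noteq> dist q b'"
  shows "\<exists>w. w \<noteq> 0 \<and> line_avoiding q w = {p. dist p b = dist p b'}"
proof -
  \<comment> \<open>With this \<open>k\<close>, the difference of the squared distances of
    \<open>p\<close> from \<open>b\<close> and \<open>b'\<close> is twice the scalar product of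
    \<open>b' - b\<close> and \<open>p - q\<close>, minus \<open>2 * k\<close>. Dividing by
    \<open>k\<close> normalises the equation of the bisector.\<close>
  define k where "k = ((q $ 1 - b' $ 1)\<^sup>2 + (q $ 2 - b' $ 2)\<^sup>2 - (q $ 1 - b $ 1)\<^sup>2 - (q $ 2 - b $ 2)\<^sup>2) / 2"
  have k: "k \<noteq> 0" using assms unfolding k_def dist_vec2 by auto
  define w where "w = (vector [(b' $ 1 - b $ 1) / k, (b' $ 2 - b $ 2) / k] :: real^2)"
  have "b \<noteq> b'" using assms by auto
  then have "w \<noteq> 0" using k unfolding w_def vec2_eq_iff by auto
  moreover have "w $ 1 * (p $ 1 - q $ 1) + w $ 2 * (p $ 2 - q $ 2) = 1 \<longleftrightarrow> dist p b = dist p b'" for p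
  proof -
    have "w $ 1 * (p $ 1 - q $ 1) + w $ 2 * (p $ 2 - q $ 2) = 1 \<longleftrightarrow>
      (b' $ 1 - b $ 1) * (p $ 1 - q $ 1) + (b' $ 2 - b $ 2) * (p $ 2 - q $ 2) = k"
    proof -
      have "w $ 1 * (p $ 1 - q $ 1) + w $ 2 * (p $ 2 - q $ 2) =
        ((b' $ 1 - b $ 1) * (p $ 1 - q $ 1) + (b' $ 2 - b $ 2) * (p $ 2 - q $ 2)) / k"
        unfolding w_def vector_2 by (simp add: add_divide_distrib)
      then show ?thesis using k by auto
    qed
    also have "\<dots> \<longleftrightarrow> (p $ 1 - b $ 1)\<^sup>2 + (p $ 2 - b $ 2)\<^sup>2 = (p $ 1 - b' $ 1)\<^sup>2 + (p $ 2 - b' $ 2)\<^sup>2"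
    proof -
      have "2 * ((b' $ 1 - b $ 1) * (p $ 1 - q $ 1) + (b' $ 2 - b $ 2) * (p $ 2 - q $ 2) - k)
        = ((p $ 1 - b $ 1)\<^sup>2 + (p $ 2 - b $ 2)\<^sup>2) - ((p $ 1 - b' $ 1)\<^sup>2 + (p $ 2 - b' $ 2)\<^sup>2)"
        unfolding k_def by (simp add: power2_eq_square field_simps)
      moreover have "S = k \<longleftrightarrow> X = Z" if "2 * (S - k) = X - Z" for S X Z :: real using that by auto
      ultimately show ?thesis by blast
    qed
    finally show ?thesis unfolding dist_vec2 by simp
  qed
  ultimately show ?thesis unfolding line_avoiding_def by blast
qed

text \<open>Two distinct points of the line that are equidistant from \<open>b\<close> and
  \<open>b'\<close> make it their bisector. Then \<open>side b - 1\<close> and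
  \<open>side b' - 1\<close> are opposite and nonzero, so not even closed half-planes hold both
  points on one side.\<close>

lemma same_side_bisector:
  fixes b b' q a a' w :: "real^2"
  defines "side \<equiv> \<lambda>p. w $ 1 * (p $ 1 - q $ 1) + w $ 2 * (p $ 2 - q $ 2)"
  assumes w: "w \<noteq> 0" and a: "a \<in> line_avoiding q w" "a' \<in> line_avoiding q w"
    and eq: "dist a b = dist a b'" "dist a' b = dist a' b'"
    and side: "(side b \<le> 1 \<and> side b' \<le> 1) \<or> (side b \<ge> 1 \<and> side b' \<ge> 1)" and ne: "b \<noteq> b'"
  shows "a = a'"
proof (rule ccontr)
  assume "a \<noteq> a'"
  define v1 v2 where "v1 = a' $ 1 - a $ 1" and "v2 = a' $ 2 - a $ 2"
  have v: "v1 \<noteq> 0 \<or> v2 \<noteq> 0" using \<open>a \<noteq> a'\<close> unfolding v1_def v2_def vec2_eq_iff by auto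
  have w0: "w $ 1 \<noteq> 0 \<or> w $ 2 \<noteq> 0" using w unfolding vec2_eq_iff by auto
  have sa: "w $ 1 * (a $ 1 - q $ 1) + w $ 2 * (a $ 2 - q $ 2) = 1"
    "w $ 1 * (a' $ 1 - q $ 1) + w $ 2 * (a' $ 2 - q $ 2) = 1"
    using a unfolding line_avoiding_def by auto
  then have "w $ 1 * v1 + w $ 2 * v2 = 0" unfolding v1_def v2_def by (simp add: algebra_simps)
  from orthogonal_vec2[OF this w0] obtain k where k: "v1 = - k * w $ 2" "v2 = k * w $ 1" by blast
  then have k0: "k \<noteq> 0" using v by auto
  have e: "(a $ 1 - b $ 1)\<^sup>2 + (a $ 2 - b $ 2)\<^sup>2 = (a $ 1 - b' $ 1)\<^sup>2 + (a $ 2 - b' $ 2)\<^sup>2"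
    "(a' $ 1 - b $ 1)\<^sup>2 + (a' $ 2 - b $ 2)\<^sup>2 = (a' $ 1 - b' $ 1)\<^sup>2 + (a' $ 2 - b' $ 2)\<^sup>2"
    using eq unfolding dist_vec2 by auto
  then have "v1 * (b' $ 1 - b $ 1) + v2 * (b' $ 2 - b $ 2) = 0"
    unfolding v1_def v2_def by (simp add: power2_eq_square algebra_simps)
  then have "k * (w $ 1 * (b' $ 2 - b $ 2) + (- w $ 2) * (b' $ 1 - b $ 1)) = 0"
    unfolding k by (simp add: algebra_simps)
  then have "(- w $ 2) * (b' $ 1 - b $ 1) + w $ 1 * (b' $ 2 - b $ 2) = 0" using k0 by simp
  from orthogonal_vec2[OF this] w0 obtain s where s: "b' $ 1 - b $ 1 = - s * w $ 1" "b' $ 2 - b $ 2 = s * - w $ 2" by auto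
  have s0: "s \<noteq> 0" using s ne unfolding vec2_eq_iff by auto
  have b': "b' $ 1 = b $ 1 - s * w $ 1" "b' $ 2 = b $ 2 - s * w $ 2" using s by auto
  have "s * (2 * (w $ 1 * (a $ 1 - b $ 1) + w $ 2 * (a $ 2 - b $ 2)) + s * ((w $ 1)\<^sup>2 + (w $ 2)\<^sup>2)) = 0"
    using e(1) unfolding b' by (simp add: power2_eq_square algebra_simps)
  then have m: "2 * (w $ 1 * (a $ 1 - b $ 1) + w $ 2 * (a $ 2 - b $ 2)) = - s * ((w $ 1)\<^sup>2 + (w $ 2)\<^sup>2)" using s0 by simp
  have sum: "2 * (side b - 1) = s * ((w $ 1)\<^sup>2 + (w $ 2)\<^sup>2)" "2 * (side b' - 1) = - s * ((w $ 1)\<^sup>2 + (w $ 2)\<^sup>2)"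
    using m sa(1) unfolding side_def b' by (simp_all add: power2_eq_square algebra_simps)
  have "(w $ 1)\<^sup>2 + (w $ 2)\<^sup>2 > 0" using w0 by (simp add: sum_power2_gt_zero_iff)
  then have "(w $ 1)\<^sup>2 + (w $ 2)\<^sup>2 \<noteq> 0" by linarith
  then have "s * ((w $ 1)\<^sup>2 + (w $ 2)\<^sup>2) \<noteq> 0" using s0 by (rule no_zero_divisors[rotated])
  then have "side b - 1 = - (side b' - 1)" "side b - 1 \<noteq> 0" using sum by auto
  then show False using side by linarith
qed

section \<open>Distinct distances\<close>

lemma ex_low_multiplicity_subsets:
  assumes \<gamma>: "plane_curve r \<gamma>" "P \<subseteq> \<gamma>" and fin: "finite P" "finite Q"
  shows "\<exists>P' Q'. P' \<subseteq> P \<and> Q' \<subseteq> Q \<and> card P \<le> 2 * (r + 1) * card P' \<and> card Q \<le> 2 * card Q' \<and>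
    (\<forall>b\<in>Q'. \<forall>b'\<in>Q'. b \<noteq> b' \<longrightarrow> card {a \<in> P'. dist a b = dist a b'} \<le> r + 1)"
proof -
  obtain q where q: "q \<notin> \<gamma>" using plane_curve_complement[OF \<gamma>(1)] by blast
  define A where "A = {w. w \<noteq> 0 \<and> line_avoiding q w \<subseteq> \<gamma>}"
  have A: "finite A" "card A \<le> r" using lines_in_curve[OF \<gamma>(1) q] unfolding A_def by auto
  define B where "B = P \<inter> (\<Union>w\<in>A. line_avoiding q w)"
  have finB: "finite B" unfolding B_def using fin by simp
  show ?thesis
  proof (cases "card P \<le> 2 * card (P - B)")
    case True
    have "card {a \<in> P - B. dist a b = dist a b'} \<le> r + 1" if "b \<noteq> b'" for b b'
    proof (rule ccontr)
      let ?T = "{a \<in> P - B. dist a b = dist a b'}"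
      assume "\<not> card ?T \<le> r + 1"
      then have big: "card ?T > r" by simp
      then have sub: "{p. dist p b = dist p b'} \<subseteq> \<gamma>"
        by (intro bisector_in_curve[OF \<gamma>(1) _ big]) (use fin \<gamma> that in auto)
      \<comment> \<open>A bisector contained in the curve misses \<open>q\<close>, so it has dual
        coordinates and its points of \<open>P\<close> lie in \<open>B\<close>.\<close>
      then have "dist q b \<noteq> dist q b'" using q by blast
      then obtain w where w: "w \<noteq> 0" "line_avoiding q w = {p. dist p b = dist p b'}"
        using bisector_eq_line_avoiding by blast
      then have "w \<in> A" unfolding A_def using sub by simp
      then have "?T \<subseteq> B" unfolding B_def using w(2) by blast
      then have "?T = {}" by blast
      then show False using big by (metis card.empty not_less_zero)
    qed
    moreover have "card P \<le> 2 * (r + 1) * card (P - B)" using True by (simp add: algebra_simps)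
    ultimately show ?thesis by (intro exI[of _ "P - B"] exI[of _ Q]) auto
  next
    case False
    have PB: "card (P - B) = card P - card B" using finB by (intro card_Diff_subset) (auto simp: B_def)
    then have B: "card P \<le> 2 * card B" "card B > 0" using False by linarith+
    \<comment> \<open>With \<open>r + 1\<close> in place of \<open>r\<close>, weak inequalities
      between the summands suffice to reach the contradiction (r + 1) |B| <= r |B|.\<close>
    have "\<exists>w\<in>A. card B \<le> (r + 1) * card (P \<inter> line_avoiding q w)"
    proof (rule ccontr)
      assume n: "\<not> ?thesis"
      have "B = (\<Union>w\<in>A. P \<inter> line_avoiding q w)" unfolding B_def by auto
      then have "card B \<le> (\<Sum>w\<in>A. card (P \<inter> line_avoiding q w))" using card_UN_le[OF A(1)] by metis
      then have "(r + 1) * card B \<le> (\<Sum>w\<in>A. (r + 1) * card (P \<inter> line_avoiding q w))"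
        by (metis mult_le_mono2 sum_distrib_left)
      also have "\<dots> \<le> (\<Sum>w\<in>A. card B)" using n by (intro sum_mono) (simp add: not_le less_imp_le)
      also have "\<dots> \<le> r * card B" using A by simp
      finally show False using B(2) by simp
    qed
    then obtain w where w: "w \<in> A" "card B \<le> (r + 1) * card (P \<inter> line_avoiding q w)" by blast
    define side where "side = (\<lambda>p::real^2. w $ 1 * (p $ 1 - q $ 1) + w $ 2 * (p $ 2 - q $ 2))"
    have "\<exists>Q'. Q' \<subseteq> Q \<and> card Q \<le> 2 * card Q' \<and> ((\<forall>b\<in>Q'. side b \<le> 1) \<or> (\<forall>b\<in>Q'. side b \<ge> 1))"
    proof -
      let ?L = "{b \<in> Q. side b \<le> 1}" and ?R = "{b \<in> Q. side b \<ge> 1}"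
      have "Q = ?L \<union> ?R" by auto
      then have "card Q \<le> card ?L + card ?R" by (metis (no_types, lifting) card_Un_le)
      then consider "card Q \<le> 2 * card ?L" | "card Q \<le> 2 * card ?R" by linarith
      then show ?thesis
      proof cases
        case 1 then show ?thesis by (intro exI[of _ ?L]) auto
      next
        case 2 then show ?thesis by (intro exI[of _ ?R]) auto
      qed
    qed
    then obtain Q' where Q': "Q' \<subseteq> Q" "card Q \<le> 2 * card Q'" "(\<forall>b\<in>Q'. side b \<le> 1) \<or> (\<forall>b\<in>Q'. side b \<ge> 1)" by blast
    let ?P = "P \<inter> line_avoiding q w"
    have "card {a \<in> ?P. dist a b = dist a b'} \<le> r + 1" if b: "b \<in> Q'" "b' \<in> Q'" "b \<noteq> b'" for b b'
    proof -
      have "w \<noteq> 0" using w(1) unfolding A_def by simp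
      have "a = a'" if "a \<in> {a \<in> ?P. dist a b = dist a b'}" "a' \<in> {a \<in> ?P. dist a b = dist a b'}" for a a'
        using same_side_bisector[OF \<open>w \<noteq> 0\<close>, of a q a' b b'] that b Q'(3) unfolding side_def by auto
      then have "card {a \<in> ?P. dist a b = dist a b'} \<le> 1"
        using fin by (intro card_le_Suc0_iff_eq[THEN iffD2, unfolded One_nat_def[symmetric]]) auto
      then show ?thesis by simp
    qed
    moreover have "card P \<le> 2 * (r + 1) * card ?P" using B(1) w(2) by (simp add: algebra_simps)
    ultimately show ?thesis using Q'(1,2) by (intro exI[of _ ?P] exI[of _ Q']) auto
  qed
qed

text \<open>The choice of \<open>t\<close> gives 12 K t <= m <= 24 K t. The lower bound on m makes
  the vertex term at most a quarter of t^2 m n, and \<open>few\<close> makes the lost incidences at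
  most half of it. The remaining quarter is bounded by the crossing term, and the upper bound on m
  turns this into 4 * 8 * 24^2 = 18432.\<close>

lemma incidence_bound_optimised:
  fixes P Q :: "(real^2) set"
  assumes fin: "finite P" "finite Q" and K: "K \<ge> 1"
    and mult: "\<And>b b'. b \<in> Q \<Longrightarrow> b' \<in> Q \<Longrightarrow> b \<noteq> b' \<Longrightarrow> card {a \<in> P. dist a b = dist a b'} \<le> K"
    and big: "12 * K \<le> card P" and few: "4 * num_distances P Q \<le> card Q"
  shows "card P * card Q \<le> 18432 * K ^ 3 * (num_distances P Q)\<^sup>2"
proof -
  define t where "t = card P div (12 * K)"
  define m n D where "m = card P" and "n = card Q" and "D = num_distances P Q"
  have t: "t \<ge> 1" unfolding t_def using big K by (simp add: Suc_leI div_greater_zero_iff)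
  have tm: "12 * K * t \<le> m" unfolding t_def m_def by simp
  have "m = t * (12 * K) + m mod (12 * K)" unfolding t_def m_def by (rule div_mult_mod_eq[symmetric])
  moreover have "m mod (12 * K) < 12 * K" using K by simp
  moreover have "1 * (12 * K) \<le> t * (12 * K)" using t by (rule mult_le_mono1)
  moreover have "24 * K * t = t * (12 * K) + t * (12 * K)" by simp
  ultimately have mt: "m \<le> 24 * K * t" by linarith
  have "t\<^sup>2 * (m * n) \<le> t\<^sup>2 * (2 * m * D) + K * (3 * t ^ 3 * n + 8 * m\<^sup>2 * D\<^sup>2)"
    unfolding m_def n_def D_def by (rule incidence_bound[OF fin mult t])
  then have main: "real t ^ 2 * (real m * real n) \<le> real t ^ 2 * (2 * real m * real D) + real K * (3 * real t ^ 3 * real n + 8 * real m ^ 2 * real D ^ 2)"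
    by (metis (mono_tags, lifting) of_nat_add of_nat_le_iff of_nat_mult of_nat_numeral of_nat_power)
  have few': "4 * real D \<le> real n" using few unfolding D_def n_def by linarith
  have tm': "12 * (real K * real t) \<le> real m" using tm by (metis (mono_tags, lifting) mult.assoc of_nat_le_iff of_nat_mult of_nat_numeral)
  have mt': "real m \<le> 24 * (real K * real t)" using mt by (metis (mono_tags, lifting) mult.assoc of_nat_le_iff of_nat_mult of_nat_numeral)
  have 1: "real t ^ 2 * (2 * real m * real D) \<le> real t ^ 2 * (real m * real n) / 2"
  proof -
    have "real t ^ 2 * real m * (4 * real D) \<le> real t ^ 2 * real m * real n"
      using few' by (intro mult_left_mono) auto
    then show ?thesis by (simp add: algebra_simps)
  qed
  have 2: "real K * (3 * real t ^ 3 * real n) \<le> real t ^ 2 * (real m * real n) / 4"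
  proof -
    have "real t ^ 2 * real n * (12 * (real K * real t)) \<le> real t ^ 2 * real n * real m"
      using tm' by (intro mult_left_mono) auto
    then show ?thesis by (simp add: algebra_simps power2_eq_square power3_eq_cube)
  qed
  have "real t ^ 2 * (real m * real n) / 4 \<le> real K * (8 * real m ^ 2 * real D ^ 2)"
    using main 1 2 by (simp add: algebra_simps)
  also have "\<dots> \<le> real K * (8 * (24 * (real K * real t)) ^ 2 * real D ^ 2)"
    using mt' by (intro mult_left_mono mult_right_mono power_mono) auto
  finally have "real t ^ 2 * (real m * real n) \<le> real t ^ 2 * (18432 * real K ^ 3 * real D ^ 2)"
    by (simp add: algebra_simps power2_eq_square power3_eq_cube)
  then have "real m * real n \<le> 18432 * real K ^ 3 * real D ^ 2"
    using t by simp
  then show ?thesis unfolding m_def n_def D_def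
    by (metis (mono_tags, lifting) of_nat_le_iff of_nat_mult of_nat_numeral of_nat_power)
qed

text \<open>If the reduced \<open>Q'\<close> has fewer than four points per distance, both sets have
  size O(D); if the reduced \<open>P'\<close> is small, then m is bounded and n <= 2 D^2. In the
  main case the reduction costs a factor 4 R, giving 4 * 18432 = 73728. The constant
  \<open>10 ^ 6\<close> exceeds this and has the square root 1000.\<close>

lemma num_distances_curve_lower_bound:
  assumes \<gamma>: "plane_curve r \<gamma>" "P \<subseteq> \<gamma>" and fin: "finite P" "finite Q" and two: "card P \<ge> 2" "card Q \<ge> 2"
  shows "card P * card Q \<le> 10 ^ 6 * (r + 1) ^ 4 * (num_distances P Q)\<^sup>2"
proof -
  define D R where "D = num_distances P Q" and "R = r + 1"
  have R: "R \<ge> 1" unfolding R_def by simp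
  obtain a a' where a: "a \<in> P" "a' \<in> P" "a \<noteq> a'"
    using two(1) fin by (metis card_le_Suc0_iff_eq not_less_eq_eq numeral_2_eq_2)
  obtain b b' where b: "b \<in> Q" "b' \<in> Q" "b \<noteq> b'"
    using two(2) fin by (metis card_le_Suc0_iff_eq not_less_eq_eq numeral_2_eq_2)
  have n: "card Q \<le> 2 * D\<^sup>2" unfolding D_def by (rule card_le_num_distances_squared[OF fin a])
  have m: "card P \<le> 2 * R\<^sup>2 * D"
    unfolding D_def R_def by (rule card_on_curve_le_num_distances[OF \<gamma> fin b]) (use a in auto)
  obtain P' Q' where PQ: "P' \<subseteq> P" "Q' \<subseteq> Q" "card P \<le> 2 * R * card P'" "card Q \<le> 2 * card Q'"
    "\<And>b b'. b \<in> Q' \<Longrightarrow> b' \<in> Q' \<Longrightarrow> b \<noteq> b' \<Longrightarrow> card {a \<in> P'. dist a b = dist a b'} \<le> R"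
    using ex_low_multiplicity_subsets[OF \<gamma> fin] unfolding R_def by blast
  have fin': "finite P'" "finite Q'" using finite_subset[OF PQ(1) fin(1)] finite_subset[OF PQ(2) fin(2)] by auto
  have D': "num_distances P' Q' \<le> D" unfolding D_def by (rule num_distances_mono[OF fin PQ(1,2)])
  have pow: "R ^ i \<le> R ^ j" if "i \<le> j" for i j using R that by (rule power_increasing[rotated])
  consider "card Q' < 4 * num_distances P' Q'" | "card P' < 12 * R"
    | "12 * R \<le> card P'" "4 * num_distances P' Q' \<le> card Q'" by linarith
  then have "card P * card Q \<le> 10 ^ 6 * (R ^ 4 * D\<^sup>2)"
  proof cases
    case 1
    then have "card Q \<le> 8 * D" using PQ(4) D' by linarith
    with m have "card P * card Q \<le> (2 * R\<^sup>2 * D) * (8 * D)" by (rule mult_le_mono)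
    also have "\<dots> = 16 * (R\<^sup>2 * D\<^sup>2)" by (simp add: power2_eq_square)
    also have "\<dots> \<le> 10 ^ 6 * (R ^ 4 * D\<^sup>2)" by (intro mult_le_mono pow) auto
    finally show ?thesis .
  next
    case 2
    have "card P \<le> 2 * R * (12 * R)" using PQ(3) 2 by (meson le_trans less_imp_le mult_le_mono2)
    then have "card P * card Q \<le> (2 * R * (12 * R)) * (2 * D\<^sup>2)" using n by (rule mult_le_mono)
    also have "\<dots> = 48 * (R\<^sup>2 * D\<^sup>2)" by (simp add: power2_eq_square)
    also have "\<dots> \<le> 10 ^ 6 * (R ^ 4 * D\<^sup>2)" by (intro mult_le_mono pow) auto
    finally show ?thesis .
  next
    case 3
    have "card P * card Q \<le> (2 * R * card P') * (2 * card Q')" using PQ(3,4) by (rule mult_le_mono)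
    also have "\<dots> = 4 * R * (card P' * card Q')" by simp
    also have "\<dots> \<le> 4 * R * (18432 * R ^ 3 * (num_distances P' Q')\<^sup>2)"
      by (intro mult_le_mono2 incidence_bound_optimised[OF fin' R PQ(5) 3])
    also have "\<dots> \<le> 4 * R * (18432 * R ^ 3 * D\<^sup>2)"
      using D' by (intro mult_le_mono2 power_mono) auto
    also have "\<dots> = 73728 * (R ^ 4 * D\<^sup>2)" by (simp add: power3_eq_cube power4_eq_xxxx)
    also have "\<dots> \<le> 10 ^ 6 * (R ^ 4 * D\<^sup>2)" by (intro mult_le_mono) auto
    finally show ?thesis .
  qed
  then show ?thesis unfolding D_def R_def by (simp add: mult.assoc)
qed

lemma num_distances_curve_sqrt_lower_bound:
  assumes "plane_curve r \<gamma>" "P \<subseteq> \<gamma>" "finite P" "finite Q" "card P \<ge> 2" "card Q \<ge> 2"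
  shows "real (num_distances P Q) \<ge> sqrt (real (card P) * real (card Q)) / (1000 * real (r + 1) ^ 2)"
proof -
  have "card P * card Q \<le> (1000 * (r + 1)\<^sup>2 * num_distances P Q)\<^sup>2"
    using num_distances_curve_lower_bound[OF assms] by (simp add: power_mult_distrib flip: power_mult)
  then have "real (card P) * real (card Q) \<le> (1000 * real (r + 1) ^ 2 * real (num_distances P Q))\<^sup>2"
    by (metis (mono_tags, lifting) of_nat_le_iff of_nat_mult of_nat_numeral of_nat_power)
  then have "sqrt (real (card P) * real (card Q)) \<le> 1000 * real (r + 1) ^ 2 * real (num_distances P Q)"
    by (rule real_le_lsqrt[rotated]) simp
  then show ?thesis by (simp add: divide_le_eq mult.commute)
qed

theorem theorem1p1:
  fixes r :: nat
  shows
    "(\<forall>A::real. A > 0 \<longrightarrow>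
       (\<exists>c::real. c > 0 \<and>
         (\<forall>(\<gamma>::(real^2) set) (P1::(real^2) set) (P2::(real^2) set) (m::nat) (n::nat).
            plane_curve r \<gamma> \<and> P1 \<subseteq> \<gamma> \<and>
            finite P1 \<and> card P1 = m \<and> finite P2 \<and> card P2 = n \<and> m \<ge> 2 \<and> n \<ge> 2 \<and>
            real m \<ge> A * (real n powr (1/2) * ln (real n) powr (-1/3))
            \<longrightarrow> real (num_distances P1 P2)
                  \<ge> c * (real m powr (1/2) * real n powr (1/2) * ln (real n) powr (-1/2)))))
     \<and>
     (\<forall>B::real. B > 0 \<longrightarrow>
       (\<exists>c::real. c > 0 \<and>
         (\<forall>(\<gamma>::(real^2) set) (P1::(real^2) set) (P2::(real^2) set) (m::nat) (n::nat).
            plane_curve r \<gamma> \<and> P1 \<subseteq> \<gamma> \<and>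
            finite P1 \<and> card P1 = m \<and> finite P2 \<and> card P2 = n \<and> m \<ge> 2 \<and> n \<ge> 2 \<and>
            real m \<le> B * (real n powr (1/2) * ln (real n) powr (-1/3))
            \<longrightarrow> real (num_distances P1 P2)
                  \<ge> c * (real m powr (1/3) * real n powr (1/2)))))"
proof -
  define c where "c = 1 / (1000 * real (r + 1) ^ 2)"
  have c: "c > 0" unfolding c_def by simp
  have bound: "c * (real m powr (1/2) * real n powr (1/2)) \<le> real (num_distances P1 P2)"
    if "plane_curve r \<gamma> \<and> P1 \<subseteq> \<gamma> \<and> finite P1 \<and> card P1 = m \<and> finite P2 \<and> card P2 = n \<and> m \<ge> 2 \<and> n \<ge> 2"
    for \<gamma> P1 P2 m n
    using num_distances_curve_sqrt_lower_bound[of r \<gamma> P1 P2] that unfolding c_def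
    by (simp add: real_sqrt_mult powr_half_sqrt)
  \<comment> \<open>For n >= 2 the logarithmic factor is largest at n = 2, so \<open>L\<close>
    bounds it uniformly.\<close>
  define L where "L = ln (2::real) powr (-1/2)"
  have L: "L > 0" unfolding L_def by simp
  have ln_bound: "ln (real n) powr (-1/2) \<le> L" if "n \<ge> 2" for n
    unfolding L_def by (rule powr_mono2') (use that in auto)
  have 1: "(c / L) * (real m powr (1/2) * real n powr (1/2) * ln (real n) powr (-1/2)) \<le> real (num_distances P1 P2)"
    if h: "plane_curve r \<gamma> \<and> P1 \<subseteq> \<gamma> \<and> finite P1 \<and> card P1 = m \<and> finite P2 \<and> card P2 = n \<and> m \<ge> 2 \<and> n \<ge> 2"
    for \<gamma> P1 P2 m n
  proof -
    have "(c / L) * (real m powr (1/2) * real n powr (1/2) * ln (real n) powr (-1/2))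
        \<le> (c / L) * (real m powr (1/2) * real n powr (1/2) * L)"
      using c L ln_bound[of n] h by (intro mult_left_mono) auto
    also have "\<dots> = c * (real m powr (1/2) * real n powr (1/2))" using L by simp
    also have "\<dots> \<le> real (num_distances P1 P2)" by (rule bound[OF h])
    finally show ?thesis .
  qed
  have 2: "c * (real m powr (1/3) * real n powr (1/2)) \<le> real (num_distances P1 P2)"
    if h: "plane_curve r \<gamma> \<and> P1 \<subseteq> \<gamma> \<and> finite P1 \<and> card P1 = m \<and> finite P2 \<and> card P2 = n \<and> m \<ge> 2 \<and> n \<ge> 2"
    for \<gamma> P1 P2 m n
  proof -
    have "real m powr (1/3) \<le> real m powr (1/2)" using h by (intro powr_mono) auto
    then have "c * (real m powr (1/3) * real n powr (1/2)) \<le> c * (real m powr (1/2) * real n powr (1/2))"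
      using c by (intro mult_left_mono mult_right_mono) auto
    then show ?thesis using bound[OF h] by linarith
  qed
  show ?thesis
  proof (intro conjI allI impI)
    fix A :: real
    show "\<exists>c>0. \<forall>\<gamma> P1 P2 m n. plane_curve r \<gamma> \<and> P1 \<subseteq> \<gamma> \<and>
        finite P1 \<and> card P1 = m \<and> finite P2 \<and> card P2 = n \<and> m \<ge> 2 \<and> n \<ge> 2 \<and>
        real m \<ge> A * (real n powr (1/2) * ln (real n) powr (-1/3))
        \<longrightarrow> real (num_distances P1 P2) \<ge> c * (real m powr (1/2) * real n powr (1/2) * ln (real n) powr (-1/2))"
      using 1 c L by (intro exI[of _ "c / L"]) (auto intro!: divide_pos_pos)
  next
    fix B :: real
    show "\<exists>c>0. \<forall>\<gamma> P1 P2 m n. plane_curve r \<gamma> \<and> P1 \<subseteq> \<gamma> \<and>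
        finite P1 \<and> card P1 = m \<and> finite P2 \<and> card P2 = n \<and> m \<ge> 2 \<and> n \<ge> 2 \<and>
        real m \<le> B * (real n powr (1/2) * ln (real n) powr (-1/3))
        \<longrightarrow> real (num_distances P1 P2) \<ge> c * (real m powr (1/3) * real n powr (1/2))"
      using 2 c by (intro exI[of _ c]) auto
  qed
qed

end
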